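(* For every integer $d \ge 1$ there is a finite graph $G$ (regarded as a simplicial complex) such that, for every integer $1\le d' \le d$, $G$ is neither weakly $d'$-Tverberg nor $d'$-Tverberg.
   Context: A simplicial complex on vertex set $[n]=\{1,\dots,n\}$ is a downward-closed family $\Delta\subseteq 2^{[n]}$; a graph is regarded as the simplicial complex consisting of the empty set, its vertices (as singletons) and its edges. A finite set $P\subseteq\mathbb{R}^d$ is in general position if for every $k\le d+1$ no $k$ points of $P$ lie on a common $(k-2)$-dimensional affine subspace. A complex $\Delta\subseteq 2^{[n]}$ is partition induced on a finite set $P\subseteq \mathbb{R}^d$ if there is a partition $\{P_1,\dots,P_n\}$ of $P$ such that for every $\sigma\subseteq[n]$, $\bigcap_{i\in\sigma}\mathrm{conv}(P_i)\neq\emptyset$ iff $\sigma\in\Delta$ (i.e. $\Delta$ is the nerve of $\{\mathrm{conv}(P_1),\dots,\mathrm{conv}(P_n)\}$). $\Delta$ is $d$-Tverberg if there is a constant $C$ such that $\Delta$ is partition induced on every point set $P\subseteq\mathbb{R}^d$ in general position with at least $C$ points. $\Delta$ is weakly $d$-Tverberg if there is a constant $C$ such that for every point set $P\subseteq\mathbb{R}^d$ in general position with at least $C$ points, $\Delta$ is partition induced on some subset of $P$. *)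

theory Defs
  imports
    "HOL-Analysis.Analysis"
    "HOL-Analysis.Finite_Function_Topology"
begin

text \<open>
  The dimension varies inside the statement, so all the spaces \<open>\<real>\<^sup>d\<close> live in one ambient real
  vector space, the finitely supported functions from \<open>nat\<close> to \<open>real\<close>: \<open>\<real>\<^sup>d\<close> is the subspace of
  those supported on the coordinates \<open>0, \<dots>, d - 1\<close>.  It is closed under \<open>convex hull\<close> and
  \<open>affine hull\<close>, so these library notions mean what they mean in \<open>\<real>\<^sup>d\<close>.
\<close>

type_synonym point = "nat \<Rightarrow>\<^sub>0 real"

definition Rn :: "nat \<Rightarrow> point set" where
  "Rn d = {x. Poly_Mapping.keys x \<subseteq> {..<d}}"

text \<open>
  \<open>flat d m A\<close>: \<open>A\<close> is an \<open>m\<close>-dimensional affine subspace of \<open>\<real>\<^sup>d\<close>; the empty set has dimension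
  \<open>-1\<close>.  (The library constant \<open>aff_dim\<close> is restricted to Euclidean spaces.)
\<close>

definition flat :: "nat \<Rightarrow> int \<Rightarrow> point set \<Rightarrow> bool" where
  "flat d m A \<longleftrightarrow> A \<subseteq> Rn d \<and> affine A \<and>
     (if A = {} then m = -1
      else \<exists>V. subspace V \<and> affine_parallel V A \<and> int (dim V) = m)"

definition general_position :: "nat \<Rightarrow> point set \<Rightarrow> bool" where
  "general_position d P \<longleftrightarrow>
     (\<forall>k \<le> d + 1. \<not> (\<exists>Q A. Q \<subseteq> P \<and> finite Q \<and> card Q = k \<and> flat d (int k - 2) A \<and> Q \<subseteq> A))"

definition simplicial_complex :: "nat \<Rightarrow> nat set set \<Rightarrow> bool" where
  "simplicial_complex n \<Delta> \<longleftrightarrow> \<Delta> \<subseteq> Pow {1..n} \<and> (\<forall>\<sigma>\<in>\<Delta>. \<forall>\<tau>. \<tau> \<subseteq> \<sigma> \<longrightarrow> \<tau> \<in> \<Delta>)"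

text \<open>
  For \<open>\<sigma> = {}\<close> the intersection below is the whole ambient space, hence nonempty, just as the
  empty intersection taken inside \<open>\<real>\<^sup>d\<close>.
\<close>

definition partition_induced :: "nat \<Rightarrow> nat set set \<Rightarrow> point set \<Rightarrow> bool" where
  "partition_induced n \<Delta> P \<longleftrightarrow>
     (\<exists>B :: nat \<Rightarrow> point set.
        (\<forall>i\<in>{1..n}. B i \<noteq> {}) \<and> disjoint_family_on B {1..n} \<and> (\<Union>i\<in>{1..n}. B i) = P \<and>
        (\<forall>\<sigma>. \<sigma> \<subseteq> {1..n} \<longrightarrow> ((\<Inter>i\<in>\<sigma>. convex hull (B i)) \<noteq> {} \<longleftrightarrow> \<sigma> \<in> \<Delta>)))"

definition tverberg :: "nat \<Rightarrow> nat \<Rightarrow> nat set set \<Rightarrow> bool" where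
  "tverberg d n \<Delta> \<longleftrightarrow>
     (\<exists>C::nat. \<forall>P. finite P \<and> P \<subseteq> Rn d \<and> general_position d P \<and> C \<le> card P \<longrightarrow>
        partition_induced n \<Delta> P)"

definition weakly_tverberg :: "nat \<Rightarrow> nat \<Rightarrow> nat set set \<Rightarrow> bool" where
  "weakly_tverberg d n \<Delta> \<longleftrightarrow>
     (\<exists>C::nat. \<forall>P. finite P \<and> P \<subseteq> Rn d \<and> general_position d P \<and> C \<le> card P \<longrightarrow>
        (\<exists>Q\<subseteq>P. partition_induced n \<Delta> Q))"

definition simple_graph :: "nat \<Rightarrow> nat set set \<Rightarrow> bool" where
  "simple_graph n E \<longleftrightarrow> (\<forall>e\<in>E. e \<subseteq> {1..n} \<and> card e = 2)"

definition graph_complex :: "nat \<Rightarrow> nat set set \<Rightarrow> nat set set" where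
  "graph_complex n E = {{}} \<union> (\<lambda>v. {v}) ` {1..n} \<union> E"

lemma simplicial_complex_graph_complex:
  assumes "simple_graph n E"
  shows "simplicial_complex n (graph_complex n E)"
  unfolding simplicial_complex_def
proof (intro conjI ballI allI impI)
  show "graph_complex n E \<subseteq> Pow {1..n}"
    using assms by (auto simp: simple_graph_def graph_complex_def)
next
  fix \<sigma> \<tau> assume s: "\<sigma> \<in> graph_complex n E" and t: "\<tau> \<subseteq> \<sigma>"
  show "\<tau> \<in> graph_complex n E"
  proof (cases "\<sigma> \<in> E")
    case True
    then have "card \<sigma> = 2" and sub: "\<sigma> \<subseteq> {1..n}"
      using assms unfolding simple_graph_def by blast+
    then obtain u v where uv: "\<sigma> = {u, v}"
      unfolding card_2_iff by blast
    then consider "\<tau> = {}" | "\<tau> = {u}" | "\<tau> = {v}" | "\<tau> = \<sigma>"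
      using t by blast
    then show ?thesis
      using True uv sub by cases (simp_all add: graph_complex_def)
  next
    case False
    then consider "\<sigma> = {}" | v where "\<sigma> = {v}" "v \<in> {1..n}"
      using s unfolding graph_complex_def by blast
    then show ?thesis
      using t by cases (auto simp: graph_complex_def subset_singleton_iff)
  qed
qed

end

theory Submission
  imports Defs "HOL-Library.Ramsey" "HOL-Computational_Algebra.Polynomial"
begin

text \<open>
  Take the points on the moment curve. There the convex hulls of two disjoint finite sets meet if
  and only if the sets alternate \<open>d + 2\<close> times along the curve, so the question becomes one about
  alternating sets of real numbers. Let \<open>G\<close> be the bipartite graph between \<open>{0, \<dots>, N - 1}\<close> and its
  power set whose edges are the pairs \<open>i \<in> S\<close>. The sets that represent the numbers rarely alternate
  with each other, so for large \<open>N\<close> many of them decompose into a bounded number of blocks, in each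
  of which they are stacked monotonically along the line. The set representing \<open>S\<close> must tell
  consecutive stacked sets apart and hence visits some block at every element of \<open>S\<close>; two
  interleaved choices of \<open>S\<close> that visit the same block many times alternate with each other,
  although they are not adjacent.
\<close>

section \<open>Alternating sets\<close>

definition alternating :: "nat \<Rightarrow> 'a::linorder set \<Rightarrow> 'a set \<Rightarrow> (nat \<Rightarrow> 'a) \<Rightarrow> bool" where
  "alternating m X Y f \<longleftrightarrow> (\<forall>i. Suc i < m \<longrightarrow> f i < f (Suc i)) \<and>
     (\<forall>i<m. f i \<in> (if even i then X else Y))"

definition alternates :: "nat \<Rightarrow> 'a::linorder set \<Rightarrow> 'a set \<Rightarrow> bool" where
  "alternates m X Y \<longleftrightarrow> (\<exists>f. alternating m X Y f \<or> alternating m Y X f)"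

lemma alternates_commute: "alternates m X Y \<longleftrightarrow> alternates m Y X"
  unfolding alternates_def by auto

lemma alternates_0 [simp]: "alternates 0 X Y"
  by (simp add: alternates_def alternating_def)

lemma alternates_mono:
  assumes "alternates m X Y" "m' \<le> m" "X \<subseteq> X'" "Y \<subseteq> Y'"
  shows "alternates m' X' Y'"
proof -
  obtain f where f: "alternating m X Y f \<or> alternating m Y X f"
    using assms(1) unfolding alternates_def by blast
  have "alternating m' X' Y' f" if "alternating m X Y f" "X \<subseteq> X'" "Y \<subseteq> Y'" for X Y X' Y'
    using that \<open>m' \<le> m\<close> unfolding alternating_def by (auto dest: less_le_trans split: if_splits)
  then have "alternating m' X' Y' f \<or> alternating m' Y' X' f" using f assms(3,4) by blast
  then show ?thesis unfolding alternates_def by blast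
qed

lemma alternating_strict_mono:
  assumes "alternating m X Y f" "i < j" "j < m"
  shows "f i < f j"
  using assms(2,3)
proof (induction j)
  case (Suc j)
  then have "f j < f (Suc j)" using assms(1) unfolding alternating_def by blast
  with Suc show ?case by (cases "i = j") (auto intro: less_trans)
qed simp

text \<open>The last point of the old chain, if any, lies in the set opposite to that of the new
  point, so comparing \<open>x\<close> with \<open>Y'\<close> and \<open>y\<close> with
  \<open>X'\<close> suffices. The parity of \<open>m\<close> decides which of the two is
  added.\<close>

lemma alternating_append:
  assumes "alternating m X' Y' f" "X' \<subseteq> X" "Y' \<subseteq> Y"
    and "x \<in> X" "\<forall>u\<in>Y'. u < x" "y \<in> Y" "\<forall>u\<in>X'. u < y"
  shows "alternating (Suc m) X Y (f(m := if even m then x else y))"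
  unfolding alternating_def
proof (intro conjI allI impI)
  fix i assume i: "Suc i < Suc m"
  show "(f(m := if even m then x else y)) i < (f(m := if even m then x else y)) (Suc i)"
  proof (cases "Suc i = m")
    case True
    then have "f i \<in> (if even i then X' else Y')" using assms(1) i unfolding alternating_def by blast
    then show ?thesis using True assms by (auto split: if_splits)
  next
    case False
    then show ?thesis using assms(1) i unfolding alternating_def by auto
  qed
next
  fix i assume "i < Suc m"
  show "(f(m := if even m then x else y)) i \<in> (if even i then X else Y)"
  proof (cases "i = m")
    case False
    then have "f i \<in> (if even i then X' else Y')"
      using assms(1) \<open>i < Suc m\<close> unfolding alternating_def by auto
    then show ?thesis using False assms(2,3) by (auto split: if_splits)
  qed (use assms(4,6) in auto)
qed

text \<open>It is unknown in which set the old chain ends, so an admissible new point is supplied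
  for either case.\<close>

lemma alternates_append:
  assumes "alternates m X' Y'" "X' \<subseteq> X" "Y' \<subseteq> Y"
    and "x \<in> X" "\<forall>u\<in>Y'. u < x" "y \<in> Y" "\<forall>u\<in>X'. u < y"
  shows "alternates (Suc m) X Y"
  using assms(1) alternating_append[OF _ assms(2-7)]
    alternating_append[OF _ assms(3) assms(2) assms(6,7) assms(4,5)]
  unfolding alternates_def by blast

text \<open>A new first point shifts every position by one, so the two sets exchange
  parities.\<close>

lemma alternating_prepend:
  assumes "alternating m X' Y' f" "X' \<subseteq> X" "Y' \<subseteq> Y"
    and "y \<in> Y" "\<forall>u\<in>X'. y < u"
  shows "alternating (Suc m) Y X (case_nat y f)"
  unfolding alternating_def
proof (intro conjI allI impI)
  fix i assume i: "Suc i < Suc m"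
  show "case_nat y f i < case_nat y f (Suc i)"
  proof (cases i)
    case 0
    then have "f 0 \<in> X'" using assms(1) i unfolding alternating_def by auto
    then show ?thesis using 0 assms(5) by auto
  next
    case (Suc j)
    then show ?thesis using assms(1) i unfolding alternating_def by auto
  qed
next
  fix i assume "i < Suc m"
  then show "case_nat y f i \<in> (if even i then Y else X)"
    using assms unfolding alternating_def by (cases i) (auto split: if_splits)
qed

lemma alternates_prepend:
  assumes "alternates m X' Y'" "X' \<subseteq> X" "Y' \<subseteq> Y"
    and "x \<in> X" "\<forall>u\<in>Y'. x < u" "y \<in> Y" "\<forall>u\<in>X'. y < u"
  shows "alternates (Suc m) X Y"
  using assms(1) alternating_prepend[OF _ assms(2,3,6,7)] alternating_prepend[OF _ assms(3,2,4,5)]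
  unfolding alternates_def by blast

section \<open>Alternation of ordered families of points\<close>

text \<open>Each index contributes one point to the chain, \<open>p x\<close> or \<open>q x\<close>
  depending on the parity. One index never supplies both, so only values at distinct indices are
  compared.\<close>

lemma alternates_image_if_increasing:
  fixes p q :: "'i::linorder \<Rightarrow> 'a::linorder"
  assumes "finite X" "\<And>x x'. x \<in> X \<Longrightarrow> x' \<in> X \<Longrightarrow> x < x' \<Longrightarrow> p x < q x' \<and> q x < p x'"
  shows "alternates (card X) (p ` X) (q ` X)"
  using assms
proof (induction X rule: finite_linorder_max_induct)
  case (insert x X)
  have "alternates (Suc (card X)) (p ` insert x X) (q ` insert x X)"
  proof (rule alternates_append)
    show "alternates (card X) (p ` X) (q ` X)" using insert by simp
    show "p x \<in> p ` insert x X" "q x \<in> q ` insert x X" by auto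
    show "\<forall>u\<in>q ` X. u < p x" "\<forall>u\<in>p ` X. u < q x" using insert by auto
  qed auto
  moreover have "x \<notin> X" using insert by auto
  ultimately show ?case using insert by simp
qed simp

text \<open>Here the smallest index carries the rightmost points, so the induction adds a new
  minimum and still appends on the right.\<close>

lemma alternates_image_if_decreasing:
  fixes p q :: "'i::linorder \<Rightarrow> 'a::linorder"
  assumes "finite X" "\<And>x x'. x \<in> X \<Longrightarrow> x' \<in> X \<Longrightarrow> x < x' \<Longrightarrow> p x' < q x \<and> q x' < p x"
  shows "alternates (card X) (p ` X) (q ` X)"
  using assms
proof (induction X rule: finite_linorder_min_induct)
  case (insert x X)
  have "alternates (Suc (card X)) (p ` insert x X) (q ` insert x X)"
  proof (rule alternates_append)
    show "alternates (card X) (p ` X) (q ` X)" using insert by simp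
    show "p x \<in> p ` insert x X" "q x \<in> q ` insert x X" by auto
    show "\<forall>u\<in>q ` X. u < p x" "\<forall>u\<in>p ` X. u < q x" using insert by auto
  qed auto
  moreover have "x \<notin> X" using insert by auto
  ultimately show ?case using insert by simp
qed simp

section \<open>Moving one of two alternating sets\<close>

text \<open>The neighbours in the chain of a point of \<open>A\<close> belong to \<open>B\<close>.
  As \<open>g x\<close> lies on the same side of every point of \<open>B\<close> as \<open>x\<close>
  does, replacing \<open>x\<close> by \<open>g x\<close> keeps the chain increasing.\<close>

lemma alternating_transfer:
  assumes f: "alternating k A B f"
    and g: "\<And>x. x \<in> A \<Longrightarrow> g x \<in> A' \<and> (\<forall>w\<in>B. (w < x \<longleftrightarrow> w < g x) \<and> (x < w \<longleftrightarrow> g x < w))"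
  shows "alternating k A' B (\<lambda>i. if even i then g (f i) else f i)"
  unfolding alternating_def
proof (intro conjI allI impI)
  fix i assume i: "Suc i < k"
  then have "f i < f (Suc i)" "f i \<in> (if even i then A else B)" "f (Suc i) \<in> (if even i then B else A)"
    using f unfolding alternating_def by force+
  then show "(if even i then g (f i) else f i) < (if even (Suc i) then g (f (Suc i)) else f (Suc i))"
    using g by (auto split: if_splits)
next
  fix i assume "i < k"
  then show "(if even i then g (f i) else f i) \<in> (if even i then A' else B)"
    using f g unfolding alternating_def by force
qed

text \<open>The counterpart of \<open>alternating_transfer\<close> for chains that start in
  \<open>B\<close>: the replaced points are at the odd positions.\<close>

lemma alternating_transfer':
  assumes f: "alternating k B A f"
    and g: "\<And>x. x \<in> A \<Longrightarrow> g x \<in> A' \<and> (\<forall>w\<in>B. (w < x \<longleftrightarrow> w < g x) \<and> (x < w \<longleftrightarrow> g x < w))"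
  shows "alternating k B A' (\<lambda>i. if even i then f i else g (f i))"
  unfolding alternating_def
proof (intro conjI allI impI)
  fix i assume i: "Suc i < k"
  then have "f i < f (Suc i)" "f i \<in> (if even i then B else A)" "f (Suc i) \<in> (if even i then A else B)"
    using f unfolding alternating_def by force+
  then show "(if even i then f i else g (f i)) < (if even (Suc i) then f (Suc i) else g (f (Suc i)))"
    using g by (auto split: if_splits)
next
  fix i assume "i < k"
  then show "(if even i then f i else g (f i)) \<in> (if even i then B else A')"
    using f g unfolding alternating_def by force
qed

text \<open>Otherwise every point of \<open>A\<close> has a partner in \<open>A'\<close> with no
  point of \<open>B\<close> between them, ends included. Moving to the partners turns the
  alternation of \<open>A\<close> with \<open>B\<close> into one of \<open>A'\<close> with
  \<open>B\<close>.\<close>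

lemma alternates_separating_point:
  assumes "alternates k A B" "\<not> alternates k A' B"
  obtains x where "x \<in> A" "\<And>y. y \<in> A' \<Longrightarrow> \<exists>w\<in>B. min x y \<le> w \<and> w \<le> max x y"
proof (rule ccontr)
  assume no: "\<not> thesis"
  have "\<forall>x\<in>A. \<exists>y\<in>A'. \<forall>w\<in>B. \<not> (min x y \<le> w \<and> w \<le> max x y)"
    using no that by meson
  then obtain g where g: "\<And>x. x \<in> A \<Longrightarrow> g x \<in> A'"
      "\<And>x w. x \<in> A \<Longrightarrow> w \<in> B \<Longrightarrow> \<not> (min x (g x) \<le> w \<and> w \<le> max x (g x))"
    by metis
  have g': "g x \<in> A' \<and> (\<forall>w\<in>B. (w < x \<longleftrightarrow> w < g x) \<and> (x < w \<longleftrightarrow> g x < w))" if "x \<in> A" for x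
  proof (intro conjI ballI g(1)[OF that])
    fix w assume "w \<in> B"
    then have "w < min x (g x) \<or> max x (g x) < w"
      using g(2)[OF that] by (meson not_le)
    then have "w < x \<and> w < g x \<or> x < w \<and> g x < w" by auto
    then show "w < x \<longleftrightarrow> w < g x" "x < w \<longleftrightarrow> g x < w"
      by (meson less_asym)+
  qed
  show False
    using assms alternating_transfer[OF _ g'] alternating_transfer'[OF _ g'] unfolding alternates_def
    by meson
qed

lemma alternates_2:
  fixes x y :: "'a::linorder"
  assumes "x \<in> X" "y \<in> Y" "x \<noteq> y"
  shows "alternates 2 X Y"
proof -
  have "alternating 2 X Y (\<lambda>i. if i = 0 then x else y)" if "x < y"
    using that assms by (auto simp: alternating_def less_2_cases_iff)
  moreover have "alternating 2 Y X (\<lambda>i. if i = 0 then y else x)" if "y < x"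
    using that assms by (auto simp: alternating_def less_2_cases_iff)
  ultimately show ?thesis using assms(3) unfolding alternates_def by (metis linorder_neqE)
qed

lemma card_if_alternates:
  assumes "alternates m X Y" "X \<union> Y \<subseteq> T" "finite T"
  shows "m \<le> card T"
proof -
  obtain f X' Y' where f: "alternating m X' Y' f" "X' \<union> Y' \<subseteq> T"
    using assms(1,2) unfolding alternates_def by blast
  have "inj_on f {..<m}"
    using alternating_strict_mono[OF f(1)] by (intro linorder_inj_onI) fastforce+
  moreover have "f i \<in> T" if "i < m" for i
  proof -
    have "f i \<in> (if even i then X' else Y')" using f(1) that unfolding alternating_def by blast
    then show ?thesis using f(2) by (auto split: if_splits)
  qed
  then have "f ` {..<m} \<subseteq> T" by blast
  ultimately show ?thesis using card_inj_on_le[of f "{..<m}" T] assms(3) by simp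
qed

text \<open>Both chains list the same \<open>m\<close>-element set in increasing order; the
  inclusion of the images is an equality because their cardinalities agree.\<close>

lemma alternating_unique:
  assumes "alternating m X Y f" "alternating m X' Y' g" "g ` {..<m} \<subseteq> f ` {..<m}" "i < m"
  shows "f i = g i"
proof -
  have s: "sorted_wrt (<) (map f [0..<m])" "sorted_wrt (<) (map g [0..<m])"
    using alternating_strict_mono[OF assms(1)] alternating_strict_mono[OF assms(2)]
    by (auto simp: sorted_wrt_iff_nth_less)
  have "inj_on g {..<m}"
    using alternating_strict_mono[OF assms(2)] by (intro linorder_inj_onI) fastforce+
  then have "card (f ` {..<m}) \<le> card (g ` {..<m})"
    using card_image_le[of "{..<m}" f] by (simp add: card_image)
  then have "g ` {..<m} = f ` {..<m}" using assms(3) by (intro card_seteq) auto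
  then have "map f [0..<m] = map g [0..<m]"
    using s by (intro strict_sorted_equal) (auto simp: atLeast0LessThan)
  then show ?thesis using assms(4) by auto
qed

section \<open>Decomposition into stacked blocks\<close>

text \<open>The block \<open>c\<close> takes one piece from each set indexed by \<open>I\<close>.
  Nonemptiness guarantees that a block containing a point of one set offers a point of every other
  one.\<close>

definition stacked :: "nat set \<Rightarrow> (nat \<Rightarrow> 'a::linorder set) \<Rightarrow> bool" where
  "stacked I c \<longleftrightarrow> (\<forall>i\<in>I. c i \<noteq> {}) \<and>
     ((\<forall>i\<in>I. \<forall>j\<in>I. i < j \<longrightarrow> (\<forall>u\<in>c i. \<forall>v\<in>c j. u < v)) \<or>
      (\<forall>i\<in>I. \<forall>j\<in>I. i < j \<longrightarrow> (\<forall>u\<in>c i. \<forall>v\<in>c j. v < u)))"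

lemma stacked_subset: "stacked I c \<Longrightarrow> J \<subseteq> I \<Longrightarrow> stacked J c"
  unfolding stacked_def by blast

text \<open>Ramsey's theorem for pairs with three colours: \<open>P\<close>, \<open>Q\<close>
  without \<open>P\<close>, and neither. The bound is chosen before \<open>I\<close>,
  \<open>P\<close> and \<open>Q\<close>, so it depends on \<open>m\<close> and \<open>m'\<close>
  only.\<close>

lemma ramsey_three_relations:
  "\<exists>N. \<forall>(I::nat set) P Q. finite I \<and> N \<le> card I \<longrightarrow>
     (\<exists>J\<subseteq>I. card J = m \<and> (\<forall>i\<in>J. \<forall>j\<in>J. i < j \<longrightarrow> P i j)) \<or>
     (\<exists>J\<subseteq>I. card J = m \<and> (\<forall>i\<in>J. \<forall>j\<in>J. i < j \<longrightarrow> Q i j)) \<or>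
     (\<exists>J\<subseteq>I. card J = m' \<and> (\<forall>i\<in>J. \<forall>j\<in>J. i < j \<longrightarrow> \<not> P i j \<and> \<not> Q i j))"
proof -
  obtain N where N: "partn_lst {..<N::nat} [m, m, m'] 2"
    using ramsey_full by blast
  have key: "(\<exists>J\<subseteq>I. card J = m \<and> (\<forall>i\<in>J. \<forall>j\<in>J. i < j \<longrightarrow> P i j)) \<or>
     (\<exists>J\<subseteq>I. card J = m \<and> (\<forall>i\<in>J. \<forall>j\<in>J. i < j \<longrightarrow> Q i j)) \<or>
     (\<exists>J\<subseteq>I. card J = m' \<and> (\<forall>i\<in>J. \<forall>j\<in>J. i < j \<longrightarrow> \<not> P i j \<and> \<not> Q i j))"
    if I: "finite I" "N \<le> card I" for I :: "nat set" and P Q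
  proof -
    have p: "partn_lst {..<card I} [m, m, m'] 2"
      using partn_lst_greater_resource[OF N I(2)] .
    \<comment> \<open>An increasing enumeration of \<open>I\<close> carries the colouring to pairs
      of positions; minimum and maximum recover the order of a pair.\<close>
    obtain e where e: "bij_betw e {..<card I} I" "strict_mono_on {..<card I} e"
      using ex_bij_betw_strict_mono_card[OF I(1)] by blast
    define f where "f = (\<lambda>s. if P (e (Min s)) (e (Max s)) then 0
       else if Q (e (Min s)) (e (Max s)) then 1 else 2::nat)"
    have "f \<in> nsets {..<card I} 2 \<rightarrow> {..<3}" by (auto simp: f_def)
    then obtain i H where iH: "i < 3" "H \<in> nsets {..<card I} ([m, m, m'] ! i)" "f ` nsets H 2 \<subseteq> {i}"
      using partn_lstE[OF p, of f 3] by (auto simp: numeral_3_eq_3)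
    have sub: "H \<subseteq> {..<card I}" using iH(2) by (auto simp: nsets_def)
    have col: "(if P (e x) (e y) then 0 else if Q (e x) (e y) then 1 else 2) = i"
      if "x \<in> H" "y \<in> H" "x < y" for x y
    proof -
      have "{x, y} \<in> nsets H 2" using that by simp
      then have "f {x, y} = i" using iH(3) by blast
      moreover have "Min {x, y} = x" "Max {x, y} = y" using that(3) by (auto simp: min_def max_def)
      ultimately show ?thesis by (simp only: f_def)
    qed
    have J: "e ` H \<subseteq> I" "card (e ` H) = [m, m, m'] ! i"
      using e(1) sub iH(2) by (auto simp: bij_betw_def nsets_def card_image inj_on_subset)
    have less: "x < y" if "x \<in> H" "y \<in> H" "e x < e y" for x y
      using that e(2) sub by (metis (no_types) not_less_iff_gr_or_eq strict_mono_onD subsetD)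
    have col': "(i = 0 \<longrightarrow> P (e x) (e y)) \<and> (i = 1 \<longrightarrow> Q (e x) (e y)) \<and>
        (i = 2 \<longrightarrow> \<not> P (e x) (e y) \<and> \<not> Q (e x) (e y))" if "x \<in> H" "y \<in> H" "x < y" for x y
      using col[OF that] by (auto split: if_splits)
    consider "i = 0" | "i = 1" | "i = 2" using iH(1) by linarith
    then show ?thesis
    proof cases
      case 1
      then have "\<forall>x\<in>e ` H. \<forall>y\<in>e ` H. x < y \<longrightarrow> P x y"
        using col' less by auto
      then show ?thesis using 1 J by auto
    next
      case 2
      then have "\<forall>x\<in>e ` H. \<forall>y\<in>e ` H. x < y \<longrightarrow> Q x y"
        using col' less by auto
      then show ?thesis using 2 J by auto
    next
      case 3
      then have "\<forall>x\<in>e ` H. \<forall>y\<in>e ` H. x < y \<longrightarrow> \<not> P x y \<and> \<not> Q x y"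
        using col' less by auto
      moreover have "card (e ` H) = m'" using 3 J(2) by (simp add: numeral_2_eq_2)
      ultimately show ?thesis using J(1) by blast
    qed
  qed
  show ?thesis by (intro exI[of _ N] allI impI) (elim conjE, rule key)
qed

text \<open>A one-dimensional Helly argument: \<open>x\<close> is the largest of the minima,
  attained by \<open>a i0\<close>. Crossing gives every other set a point beyond some point of
  \<open>a i0\<close>, hence beyond \<open>x\<close>. The index \<open>i0\<close> is excluded
  because \<open>a i0\<close> has no point below \<open>x\<close>.\<close>

lemma crossing_point:
  fixes a :: "nat \<Rightarrow> 'a::linorder set"
  assumes fin: "finite I" "I \<noteq> {}" and a: "\<And>i. i \<in> I \<Longrightarrow> finite (a i) \<and> a i \<noteq> {}"
    and disj: "\<And>i j. i \<in> I \<Longrightarrow> j \<in> I \<Longrightarrow> i \<noteq> j \<Longrightarrow> a i \<inter> a j = {}"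
    and cross: "\<And>i j. i \<in> I \<Longrightarrow> j \<in> I \<Longrightarrow> i \<noteq> j \<Longrightarrow> \<exists>u\<in>a i. \<exists>v\<in>a j. u < v"
  obtains i0 x where "i0 \<in> I" "\<And>i. i \<in> I - {i0} \<Longrightarrow> (\<exists>u\<in>a i. u < x) \<and> (\<exists>u\<in>a i. x \<le> u)"
proof -
  define M where "M = (\<lambda>i. Min (a i)) ` I"
  have "finite M" "M \<noteq> {}" using fin by (auto simp: M_def)
  then have "Max M \<in> M" by simp
  then obtain i0 where i0: "i0 \<in> I" "Max M = Min (a i0)" by (auto simp: M_def)
  have "(\<exists>u\<in>a i. u < Max M) \<and> (\<exists>u\<in>a i. Max M \<le> u)" if i: "i \<in> I - {i0}" for i
  proof
    have "Min (a i) \<in> a i" "Min (a i0) \<in> a i0" using a i i0 by auto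
    moreover have "Min (a i) \<le> Max M" using i \<open>finite M\<close> by (auto simp: M_def)
    moreover have "Min (a i) \<noteq> Max M" using calculation(1,2) disj[of i i0] i i0 by auto
    ultimately show "\<exists>u\<in>a i. u < Max M" by (metis less_le)
    obtain u v where uv: "u \<in> a i0" "v \<in> a i" "u < v" using cross[of i0 i] i i0 by auto
    then have "Max M \<le> u" using i0 a by auto
    then show "\<exists>u\<in>a i. Max M \<le> u" using uv by (meson le_less_trans less_imp_le)
  qed
  then show thesis using that i0(1) by blast
qed

text \<open>Among many sets, Ramsey's theorem finds many whose convex hulls are disjoint and ordered
  monotonically, or many whose convex hulls meet pairwise. In the second case the convex hulls have
  a common point; cutting there leaves on either side sets that alternate once less.\<close>

lemma stacked_decomposition:
  "\<exists>N. \<forall>(a :: nat \<Rightarrow> 'a::linorder set) I. finite I \<and> N \<le> card I \<and>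
     (\<forall>i\<in>I. finite (a i) \<and> a i \<noteq> {}) \<and>
     (\<forall>i\<in>I. \<forall>j\<in>I. i \<noteq> j \<longrightarrow> a i \<inter> a j = {} \<and> \<not> alternates k (a i) (a j)) \<longrightarrow>
     (\<exists>J C. J \<subseteq> I \<and> card J = m \<and> finite C \<and> card C \<le> 2 ^ k \<and> (\<forall>c\<in>C. stacked J c) \<and>
        (\<forall>i\<in>J. a i = (\<Union>c\<in>C. c i)))"
proof (induction k arbitrary: m)
  case 0
  show ?case
  \<comment> \<open>Chains of length 0 always exist, so two distinct indices already contradict the
    hypothesis.\<close>
  proof (intro exI[of _ 2] allI impI)
    fix a :: "nat \<Rightarrow> 'a::linorder set" and I :: "nat set"
    assume *: "finite I \<and> 2 \<le> card I \<and> (\<forall>i\<in>I. finite (a i) \<and> a i \<noteq> {}) \<and>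
     (\<forall>i\<in>I. \<forall>j\<in>I. i \<noteq> j \<longrightarrow> a i \<inter> a j = {} \<and> \<not> alternates 0 (a i) (a j))"
    then obtain i j where "i \<in> I" "j \<in> I" "i \<noteq> j"
      by (metis One_nat_def Suc_1 card_le_Suc0_iff_eq not_less_eq_eq)
    then have False using * by auto
    then show "\<exists>J C. J \<subseteq> I \<and> card J = m \<and> finite C \<and> card C \<le> 2 ^ 0 \<and> (\<forall>c\<in>C. stacked J c) \<and>
        (\<forall>i\<in>J. a i = (\<Union>c\<in>C. c i))" ..
  qed
next
  case (Suc k)
  define good where "good = (\<lambda>k m (a :: nat \<Rightarrow> 'a set) I. \<exists>J C. J \<subseteq> I \<and> card J = m \<and> finite C \<and>
    card C \<le> 2 ^ k \<and> (\<forall>c\<in>C. stacked J c) \<and> (\<forall>i\<in>J. a i = (\<Union>c\<in>C. c i)))"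
  define hyp where "hyp = (\<lambda>k (a :: nat \<Rightarrow> 'a set) I. (\<forall>i\<in>I. finite (a i) \<and> a i \<noteq> {}) \<and>
     (\<forall>i\<in>I. \<forall>j\<in>I. i \<noteq> j \<longrightarrow> a i \<inter> a j = {} \<and> \<not> alternates k (a i) (a j)))"
  have "\<exists>N. \<forall>a I. finite I \<and> N \<le> card I \<and> hyp k a I \<longrightarrow> good k m a I" for m
    using Suc.IH[of m] unfolding good_def hyp_def by simp
  then obtain F where F: "\<And>m a I. finite I \<Longrightarrow> F m \<le> card I \<Longrightarrow> hyp k a I \<Longrightarrow> good k m a I"
    by metis
  \<comment> \<open>In the third case one index is lost to \<open>i0\<close>. The parts left of the
    cut need \<open>F (F m)\<close> indices to retain \<open>F m\<close>, and the parts right of it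
    reduce these to \<open>m\<close>.\<close>
  obtain N where N: "\<forall>(I::nat set) P Q. finite I \<and> N \<le> card I \<longrightarrow>
     (\<exists>J\<subseteq>I. card J = m \<and> (\<forall>i\<in>J. \<forall>j\<in>J. i < j \<longrightarrow> P i j)) \<or>
     (\<exists>J\<subseteq>I. card J = m \<and> (\<forall>i\<in>J. \<forall>j\<in>J. i < j \<longrightarrow> Q i j)) \<or>
     (\<exists>J\<subseteq>I. card J = Suc (F (F m)) \<and> (\<forall>i\<in>J. \<forall>j\<in>J. i < j \<longrightarrow> \<not> P i j \<and> \<not> Q i j))"
    using ramsey_three_relations[of m "Suc (F (F m))"] by (rule exE)
  have "good (Suc k) m a I" if I: "finite I" "N \<le> card I" and h: "hyp (Suc k) a I" for a I
  proof -
    let ?P = "\<lambda>i j. \<forall>u\<in>a i. \<forall>v\<in>a j. u < v" and ?Q = "\<lambda>i j. \<forall>u\<in>a i. \<forall>v\<in>a j. v < u"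
    have one_block: ?thesis if "J \<subseteq> I" "card J = m" "stacked J a" for J
      unfolding good_def using that by (intro exI[of _ J] exI[of _ "{a}"]) auto
    have ne: "\<forall>i\<in>I. a i \<noteq> {}" using h unfolding hyp_def by blast
    from N[rule_format, OF conjI[OF I], of ?P ?Q] show ?thesis
    proof (elim disjE exE conjE)
      fix J assume J: "J \<subseteq> I" "card J = m" "\<forall>i\<in>J. \<forall>j\<in>J. i < j \<longrightarrow> ?P i j"
      then have "stacked J a" using ne unfolding stacked_def by blast
      then show ?thesis using one_block J by blast
    next
      fix J assume J: "J \<subseteq> I" "card J = m" "\<forall>i\<in>J. \<forall>j\<in>J. i < j \<longrightarrow> ?Q i j"
      then have "stacked J a" using ne unfolding stacked_def by blast
      then show ?thesis using one_block J by blast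
    next
      fix J assume 3: "J \<subseteq> I" "card J = Suc (F (F m))"
        "\<forall>i\<in>J. \<forall>j\<in>J. i < j \<longrightarrow> \<not> ?P i j \<and> \<not> ?Q i j"
      have finJ: "finite J" using 3(1) I(1) finite_subset by blast
      have hJ: "\<And>i. i \<in> J \<Longrightarrow> finite (a i) \<and> a i \<noteq> {}"
        "\<And>i j. i \<in> J \<Longrightarrow> j \<in> J \<Longrightarrow> i \<noteq> j \<Longrightarrow> a i \<inter> a j = {}"
        "\<And>i j. i \<in> J \<Longrightarrow> j \<in> J \<Longrightarrow> i \<noteq> j \<Longrightarrow> \<not> alternates (Suc k) (a i) (a j)"
        using h 3(1) unfolding hyp_def by (meson subsetD)+
      \<comment> \<open>If \<open>j < i\<close>, the failure of \<open>?P j i\<close> is that of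
        \<open>?Q i j\<close>. Disjointness then makes the inequality strict.\<close>
      have cross: "\<exists>u\<in>a i. \<exists>v\<in>a j. u < v" if ij: "i \<in> J" "j \<in> J" "i \<noteq> j" for i j
      proof -
        have "\<not> ?Q i j" using ij 3(3) by (metis linorder_neqE_nat)
        then show ?thesis using hJ(2)[OF ij] by (metis disjoint_iff not_less_iff_gr_or_eq)
      qed
      have Jne: "J \<noteq> {}" using 3(2) by auto
      obtain i0 x where i0: "i0 \<in> J"
        and x: "\<And>i. i \<in> J - {i0} \<Longrightarrow> (\<exists>u\<in>a i. u < x) \<and> (\<exists>u\<in>a i. x \<le> u)"
        using crossing_point[of J a, OF finJ Jne hJ(1,2) cross] by blast
      define L where "L = (\<lambda>i. {u\<in>a i. u < x})"
      define R where "R = (\<lambda>i. {u\<in>a i. x \<le> u})"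
      have split: "a i = L i \<union> R i" for i by (auto simp: L_def R_def)
      \<comment> \<open>Both sets have points at or right of the cut, so an alternation of the left
        parts could be lengthened by one, whichever set it ends in.\<close>
      have altL: "\<not> alternates k (L i) (L j)" if ij: "i \<in> J - {i0}" "j \<in> J - {i0}" "i \<noteq> j" for i j
      proof
        assume alt: "alternates k (L i) (L j)"
        obtain u v where "u \<in> a i" "x \<le> u" "v \<in> a j" "x \<le> v" using x ij by meson
        then have "alternates (Suc k) (a i) (a j)"
          by (intro alternates_append[OF alt, of _ _ u v]) (auto simp: L_def)
        then show False using hJ(3) ij by blast
      qed
      have altR: "\<not> alternates k (R i) (R j)" if ij: "i \<in> J - {i0}" "j \<in> J - {i0}" "i \<noteq> j" for i j
      proof
        assume alt: "alternates k (R i) (R j)"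
        obtain u v where "u \<in> a i" "u < x" "v \<in> a j" "v < x" using x ij by meson
        then have "alternates (Suc k) (a i) (a j)"
          by (intro alternates_prepend[OF alt, of _ _ u v]) (auto simp: R_def)
        then show False using hJ(3) ij by blast
      qed
      have fin_ne: "finite (L i) \<and> L i \<noteq> {} \<and> finite (R i) \<and> R i \<noteq> {}" if "i \<in> J - {i0}" for i
        using x[OF that] hJ(1)[of i] that unfolding L_def R_def by auto
      have disj: "L i \<inter> L j = {} \<and> R i \<inter> R j = {}" if "i \<in> J" "j \<in> J" "i \<noteq> j" for i j
        using hJ(2)[OF that] unfolding L_def R_def by blast
      have "hyp k L (J - {i0})"
        unfolding hyp_def using fin_ne disj altL by blast
      moreover have "F (F m) \<le> card (J - {i0})" using 3(2) i0 by simp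
      ultimately have "good k (F m) L (J - {i0})" using F finJ by simp
      then obtain J1 C1 where J1: "J1 \<subseteq> J - {i0}" "card J1 = F m" "finite C1" "card C1 \<le> 2 ^ k"
        "\<forall>c\<in>C1. stacked J1 c" "\<forall>i\<in>J1. L i = (\<Union>c\<in>C1. c i)"
        unfolding good_def by (elim exE conjE) (rule that; assumption)
      \<comment> \<open>The second pass stays inside \<open>J1\<close>, so the blocks in
        \<open>C1\<close> remain stacked on the final index set and the two bounds on the number of
        blocks add up.\<close>
      have "hyp k R J1"
        unfolding hyp_def
      proof (intro conjI ballI impI)
        fix i j assume ij: "i \<in> J1" "j \<in> J1" "i \<noteq> j"
        then have "i \<in> J - {i0}" "j \<in> J - {i0}" using J1(1) by auto
        then show "R i \<inter> R j = {}" "\<not> alternates k (R i) (R j)" using disj altR ij(3) by auto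
      qed (use fin_ne J1(1) in auto)
      moreover have "finite J1" using J1(1) finJ finite_subset by blast
      ultimately have "good k m R J1" using F J1(2) by simp
      then obtain J2 C2 where J2: "J2 \<subseteq> J1" "card J2 = m" "finite C2" "card C2 \<le> 2 ^ k"
        "\<forall>c\<in>C2. stacked J2 c" "\<forall>i\<in>J2. R i = (\<Union>c\<in>C2. c i)"
        unfolding good_def by (elim exE conjE) (rule that; assumption)
      have "J2 \<subseteq> I" using J2(1) J1(1) 3(1) by blast
      moreover have "card (C1 \<union> C2) \<le> 2 ^ Suc k"
        using card_Un_le[of C1 C2] J1(4) J2(4) by simp
      moreover have "\<forall>c\<in>C1 \<union> C2. stacked J2 c"
        using J1(5) J2(1,5) stacked_subset by blast
      moreover have "\<forall>i\<in>J2. a i = (\<Union>c\<in>C1 \<union> C2. c i)"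
        using J2(1,6) J1(6) split by (metis UN_Un subsetD)
      moreover have "finite (C1 \<union> C2)" using J1(3) J2(3) by simp
      ultimately show ?thesis unfolding good_def using J2(2) by blast
    qed
  qed
  then show ?case unfolding good_def hyp_def by (intro exI[of _ N] allI impI) (elim conjE; blast)
qed

section \<open>The membership graph\<close>

text \<open>In the notation of the proof, \<open>b (S u)\<close> tells \<open>a (e (2 * z x u))\<close> from
  \<open>a (e (Suc (2 * z x u)))\<close> for every \<open>x\<close>, so it has a point close to these two sets in some block
  \<open>c\<close>. There are more values of \<open>u\<close> than blocks, so two of them share a block for many \<open>x\<close>, and
  there the sets \<open>b (S u)\<close> and \<open>b (S v)\<close> alternate too often.\<close>

lemma membership_graph_not_alternation_graph:
  "\<exists>N. \<forall>k\<le>K. \<forall>(a :: nat \<Rightarrow> 'a::linorder set) b. \<not> (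
     (\<forall>i<N. finite (a i) \<and> a i \<noteq> {}) \<and>
     (\<forall>i<N. \<forall>j<N. i \<noteq> j \<longrightarrow> a i \<inter> a j = {} \<and> \<not> alternates k (a i) (a j)) \<and>
     (\<forall>S T. S \<subseteq> {..<N} \<and> T \<subseteq> {..<N} \<and> S \<noteq> T \<longrightarrow> \<not> alternates k (b S) (b T)) \<and>
     (\<forall>i<N. \<forall>S. S \<subseteq> {..<N} \<longrightarrow> (alternates k (a i) (b S) \<longleftrightarrow> i \<in> S)))"
proof -
  \<comment> \<open>One more value of \<open>u\<close> than there can be blocks.\<close>
  define U where "U = Suc (2 ^ K)"
  \<comment> \<open>Enough values of \<open>x\<close> for some triple of two numbers below
    \<open>U\<close> and a block to occur at least \<open>Suc K\<close> times.\<close>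
  define R where "R = Suc K * (U * (U * 2 ^ K))"
  \<comment> \<open>Two consecutive indices for every pair of \<open>x < R\<close> and
    \<open>u < U\<close>.\<close>
  define m where "m = 2 * (U * R)"
  obtain N where N: "\<forall>(a :: nat \<Rightarrow> 'a set) I. finite I \<and> N \<le> card I \<and>
     (\<forall>i\<in>I. finite (a i) \<and> a i \<noteq> {}) \<and>
     (\<forall>i\<in>I. \<forall>j\<in>I. i \<noteq> j \<longrightarrow> a i \<inter> a j = {} \<and> \<not> alternates K (a i) (a j)) \<longrightarrow>
     (\<exists>J C. J \<subseteq> I \<and> card J = m \<and> finite C \<and> card C \<le> 2 ^ K \<and> (\<forall>c\<in>C. stacked J c) \<and>
        (\<forall>i\<in>J. a i = (\<Union>c\<in>C. c i)))"
    using stacked_decomposition[of K m] by (rule exE)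
  have impossible: False if "k \<le> K"
    and fin_ne: "\<forall>i<N. finite (a i) \<and> a i \<noteq> {}"
    and aa: "\<forall>i<N. \<forall>j<N. i \<noteq> j \<longrightarrow> a i \<inter> a j = {} \<and> \<not> alternates k (a i) (a j)"
    and bb: "\<forall>S T. S \<subseteq> {..<N} \<and> T \<subseteq> {..<N} \<and> S \<noteq> T \<longrightarrow> \<not> alternates k (b S) (b T)"
    and ab: "\<forall>i<N. \<forall>S. S \<subseteq> {..<N} \<longrightarrow> (alternates k (a i) (b S) \<longleftrightarrow> i \<in> S)"
    for k and a :: "nat \<Rightarrow> 'a set" and b
  proof -
    \<comment> \<open>A chain of length \<open>K\<close> contains one of length \<open>k\<close>, so
      the decomposition for \<open>K\<close> serves every \<open>k \<le> K\<close>.\<close>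
    have aaK: "\<forall>i\<in>{..<N}. \<forall>j\<in>{..<N}. i \<noteq> j \<longrightarrow> a i \<inter> a j = {} \<and> \<not> alternates K (a i) (a j)"
      using aa alternates_mono[OF _ \<open>k \<le> K\<close> order_refl order_refl] by blast
    have "\<exists>J C. J \<subseteq> {..<N} \<and> card J = m \<and> finite C \<and> card C \<le> 2 ^ K \<and> (\<forall>c\<in>C. stacked J c) \<and>
        (\<forall>i\<in>J. a i = (\<Union>c\<in>C. c i))"
      by (rule N[rule_format]) (use fin_ne aaK in auto)
    then obtain J C where J: "J \<subseteq> {..<N}" "card J = m" and C: "finite C" "card C \<le> 2 ^ K"
        and st: "\<forall>c\<in>C. stacked J c" and dec: "\<forall>i\<in>J. a i = (\<Union>c\<in>C. c i)"
      by (elim exE conjE) (rule that; assumption)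
    have "finite J" using J(1) finite_subset by blast
    then obtain e where e: "bij_betw e {..<m} J" "strict_mono_on {..<m} e"
      using ex_bij_betw_strict_mono_card[of J] J(2) by metis
    have inj: "inj_on e {..<m}" and eJ: "\<And>i. i < m \<Longrightarrow> e i \<in> J"
      using e(1) by (auto simp: bij_betw_def)
    have eN: "e i < N" if "i < m" for i using eJ[OF that] J(1) by auto
    have e_less: "e i < e j" if "i < j" "j < m" for i j
      using e(2) that by (auto simp: strict_mono_on_def)
    define z where "z = (\<lambda>x u. U * x + u)"
    have z_less: "z x u < z y v" if "x < y" "u < U" for x y u v
    proof -
      have "z x u < U * Suc x" using that by (simp add: z_def)
      also have "\<dots> \<le> U * y" using that by (intro mult_le_mono2) simp
      finally show ?thesis by (simp add: z_def)
    qed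
    have z_bound: "z x u < U * R" if "x < R" "u < U" for x u
      using z_less[of x R u 0] that by (simp add: z_def)
    have z_inj: "x = y \<and> u = v" if "z x u = z y v" "u < U" "v < U" for x y u v
      using that z_less[of x y u v] z_less[of y x v u] by (cases x y rule: linorder_cases) (auto simp: z_def)
    have zm: "2 * z x u < m" "Suc (2 * z x u) < m" if "x < R" "u < U" for x u
      using z_bound[OF that] by (auto simp: m_def)
    \<comment> \<open>Of the two indices of a pair, \<open>S u\<close> receives the even one and
      omits the odd one, so \<open>b (S u)\<close> has to distinguish the two sets.\<close>
    define S where "S = (\<lambda>u. (\<lambda>x. e (2 * z x u)) ` {..<R})"
    have SN: "S u \<subseteq> {..<N}" if "u < U" for u
      using eN zm that by (auto simp: S_def)
    have hi: "e (Suc (2 * z x u)) \<notin> S u" if "x < R" "u < U" for x u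
    proof
      assume "e (Suc (2 * z x u)) \<in> S u"
      then obtain y where "y < R" "e (Suc (2 * z x u)) = e (2 * z y u)" by (auto simp: S_def)
      then have "Suc (2 * z x u) = 2 * z y u" using inj zm that by (auto dest: inj_onD)
      then show False by presburger
    qed
    have "0 < R" by (simp add: R_def U_def)
    have S_ne: "S u \<noteq> S v" if "u < U" "v < U" "u \<noteq> v" for u v
    proof
      assume "S u = S v"
      moreover have "e (2 * z 0 u) \<in> S u" using \<open>0 < R\<close> by (auto simp: S_def)
      ultimately obtain y where "y < R" "e (2 * z 0 u) = e (2 * z y v)" by (auto simp: S_def)
      then have "2 * z 0 u = 2 * z y v" using inj zm that \<open>0 < R\<close> by (auto dest: inj_onD)
      then show False using z_inj[of 0 u y v] that by simp
    qed
    have "\<exists>c w. c \<in> C \<and> w \<in> b (S u) \<and> (\<exists>s \<in> c (e (2 * z x u)). \<exists>t \<in> c (e (Suc (2 * z x u))).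
        min s t \<le> w \<and> w \<le> max s t)" if xu: "x < R" "u < U" for x u
    proof -
      let ?l = "e (2 * z x u)" and ?h = "e (Suc (2 * z x u))"
      have "?l \<in> S u" using xu by (auto simp: S_def)
      then have "alternates k (a ?l) (b (S u))"
        using ab[rule_format, OF eN[OF zm(1)[OF xu]] SN[OF xu(2)]] by blast
      moreover have "\<not> alternates k (a ?h) (b (S u))"
        using ab[rule_format, OF eN[OF zm(2)[OF xu]] SN[OF xu(2)]] hi[OF xu] by blast
      ultimately obtain s where s: "s \<in> a ?l"
          "\<And>y. y \<in> a ?h \<Longrightarrow> \<exists>w\<in>b (S u). min s y \<le> w \<and> w \<le> max s y"
        using alternates_separating_point by blast
      have lJ: "?l \<in> J" and hJ: "?h \<in> J" using eJ zm xu by auto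
      \<comment> \<open>The block is chosen to contain \<open>s\<close>; being stacked, it also has
        a point \<open>t\<close> in the neighbouring set, and \<open>s\<close> is separated from all
        points there.\<close>
      obtain c where c: "c \<in> C" "s \<in> c ?l" using s(1) dec lJ by auto
      then obtain t where t: "t \<in> c ?h" using st hJ unfolding stacked_def by blast
      then have "t \<in> a ?h" using dec hJ c(1) by auto
      then show ?thesis using s(2) c t by blast
    qed
    then obtain cc ww where cw: "\<And>x u. x < R \<Longrightarrow> u < U \<Longrightarrow> cc x u \<in> C \<and> ww x u \<in> b (S u) \<and>
        (\<exists>s \<in> cc x u (e (2 * z x u)). \<exists>t \<in> cc x u (e (Suc (2 * z x u))).
          min s t \<le> ww x u \<and> ww x u \<le> max s t)"
      by metis
    have "\<exists>u v. u < U \<and> v < U \<and> u \<noteq> v \<and> cc x u = cc x v" if "x < R" for x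
    proof -
      have "cc x ` {..<U} \<subseteq> C" using cw that by auto
      then have "card (cc x ` {..<U}) < card {..<U}"
        using C card_mono[of C "cc x ` {..<U}"] by (simp add: U_def)
      then have "\<not> inj_on (cc x) {..<U}" by (rule pigeonhole)
      then show ?thesis by (auto simp: inj_on_def)
    qed
    then obtain us vs where uv: "\<And>x. x < R \<Longrightarrow>
        us x < U \<and> vs x < U \<and> us x \<noteq> vs x \<and> cc x (us x) = cc x (vs x)"
      by metis
    let ?B = "{..<U} \<times> {..<U} \<times> C"
    let ?f = "\<lambda>x. (us x, vs x, cc x (us x))"
    have f: "?f \<in> {..<R} \<rightarrow> ?B" using uv cw by auto
    then have Bne: "?B \<noteq> {}" using \<open>0 < R\<close> by blast
    obtain u v c where uvc: "(u, v, c) \<in> ?B"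
        "card {..<R} \<le> card (?f -` {(u, v, c)} \<inter> {..<R}) * card ?B"
      using pigeonhole_card[OF f _ _ Bne] C(1) by auto
    define X where "X = ?f -` {(u, v, c)} \<inter> {..<R}"
    have "Suc K * card ?B \<le> R"
      unfolding R_def using C(2) by (intro mult_le_mono2) (simp add: card_cartesian_product)
    also have "R \<le> card X * card ?B" using uvc(2) by (simp add: X_def)
    finally have "Suc K * card ?B \<le> card X * card ?B" .
    moreover have "card ?B > 0" using Bne C(1) by (subst card_gt_0_iff) simp
    ultimately have "Suc K \<le> card X" unfolding mult_le_cancel2 by blast
    have X: "x < R" "us x = u" "vs x = v" "cc x u = c" "cc x v = c" if "x \<in> X" for x
      using that uv[of x] by (auto simp: X_def)
    have uvU: "u < U" "v < U" "c \<in> C" using uvc(1) by auto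
    have "finite X" by (simp add: X_def)
    then obtain x0 where "x0 \<in> X" using \<open>Suc K \<le> card X\<close> by fastforce
    then have "u \<noteq> v" using uv X by metis
    have between: "\<exists>s \<in> c (e (2 * z x r)). \<exists>t \<in> c (e (Suc (2 * z x r))).
          min s t \<le> ww x r \<and> ww x r \<le> max s t" "ww x r \<in> b (S r)" if "x \<in> X" "r \<in> {u, v}" for x r
      using cw[of x r] X[OF that(1)] uvU that(2) by auto
    have order: "e (2 * z x r) < e (2 * z y r')" "e (2 * z x r) < e (Suc (2 * z y r'))"
      "e (Suc (2 * z x r)) < e (2 * z y r')" "e (Suc (2 * z x r)) < e (Suc (2 * z y r'))"
      if "x \<in> X" "y \<in> X" "x < y" "r \<in> {u, v}" "r' \<in> {u, v}" for x y r r'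
      using z_less[of x y r r'] zm[of y r'] X(1)[of y] that uvU by (auto intro!: e_less)
    have inJ: "e (2 * z x r) \<in> J" "e (Suc (2 * z x r)) \<in> J" if "x \<in> X" "r \<in> {u, v}" for x r
      using eJ zm X(1) that uvU by auto
    \<comment> \<open>In the block \<open>c\<close>, the intervals from \<open>min s t\<close> to
      \<open>max s t\<close> for distinct \<open>x\<close> are disjoint and ordered monotonically in
      \<open>x\<close>, both for \<open>u\<close> and for \<open>v\<close>, and so are the witnesses
      inside them.\<close>
    have "alternates (card X) ((\<lambda>x. ww x u) ` X) ((\<lambda>x. ww x v) ` X)"
      using st[rule_format, OF uvU(3)] unfolding stacked_def
    proof (elim conjE disjE)
      assume inc: "\<forall>i\<in>J. \<forall>j\<in>J. i < j \<longrightarrow> (\<forall>u\<in>c i. \<forall>v\<in>c j. u < v)"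
      have "ww x r < ww y r'" if xy: "x \<in> X" "y \<in> X" "x < y" "r \<in> {u, v}" "r' \<in> {u, v}" for x y r r'
      proof -
        obtain s t where st: "s \<in> c (e (2 * z x r))" "t \<in> c (e (Suc (2 * z x r)))" "ww x r \<le> max s t"
          using between(1)[OF xy(1,4)] by blast
        obtain s' t' where st': "s' \<in> c (e (2 * z y r'))" "t' \<in> c (e (Suc (2 * z y r')))"
            "min s' t' \<le> ww y r'"
          using between(1)[OF xy(2,5)] by blast
        have "s < s'" "s < t'" "t < s'" "t < t'"
          using inc order[OF xy] inJ[OF xy(1,4)] inJ[OF xy(2,5)] st st' by blast+
        then have "max s t < min s' t'" by simp
        then show ?thesis using st(3) st'(3) by (meson le_less_trans less_le_trans)
      qed
      then show ?thesis using \<open>finite X\<close> by (intro alternates_image_if_increasing) auto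
    next
      assume dec: "\<forall>i\<in>J. \<forall>j\<in>J. i < j \<longrightarrow> (\<forall>u\<in>c i. \<forall>v\<in>c j. v < u)"
      have "ww y r' < ww x r" if xy: "x \<in> X" "y \<in> X" "x < y" "r \<in> {u, v}" "r' \<in> {u, v}" for x y r r'
      proof -
        obtain s t where st: "s \<in> c (e (2 * z x r))" "t \<in> c (e (Suc (2 * z x r)))" "min s t \<le> ww x r"
          using between(1)[OF xy(1,4)] by blast
        obtain s' t' where st': "s' \<in> c (e (2 * z y r'))" "t' \<in> c (e (Suc (2 * z y r')))"
            "ww y r' \<le> max s' t'"
          using between(1)[OF xy(2,5)] by blast
        have "s' < s" "t' < s" "s' < t" "t' < t"
          using dec order[OF xy] inJ[OF xy(1,4)] inJ[OF xy(2,5)] st st' by blast+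
        then have "max s' t' < min s t" by simp
        then show ?thesis using st(3) st'(3) by (meson le_less_trans less_le_trans)
      qed
      then show ?thesis using \<open>finite X\<close> by (intro alternates_image_if_decreasing) auto
    qed
    then have "alternates k (b (S u)) (b (S v))"
      by (rule alternates_mono) (use \<open>k \<le> K\<close> \<open>Suc K \<le> card X\<close> between(2) in auto)
    then show False
      using bb[rule_format, OF conjI[OF SN[OF uvU(1)] conjI[OF SN[OF uvU(2)] S_ne[OF uvU(1,2) \<open>u \<noteq> v\<close>]]]]
      by contradiction
  qed
  show ?thesis
    by (intro exI[of _ N] allI impI notI) (elim conjE, rule impossible; assumption)
qed

section \<open>The moment curve\<close>

text \<open>The last conjunct (no sign change to the right of all points) makes the induction work.\<close>

lemma exists_separating_poly:
  fixes X Y :: "real set"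
  assumes "finite X" "finite Y" "X \<inter> Y = {}" "\<not> alternates (m + 2) X Y"
  shows "\<exists>q. degree q \<le> m \<and> (\<forall>x\<in>X. 0 < poly q x) \<and> (\<forall>y\<in>Y. poly q y < 0) \<and>
     (\<forall>s t. s \<le> t \<and> (\<forall>w\<in>X \<union> Y. w \<le> s) \<longrightarrow> 0 < poly q s * poly q t)"
    (is "?sep m X Y")
  using assms
proof (induction m arbitrary: X Y)
  case 0
  \<comment> \<open>Without an alternation of length 2 one set is empty, and a nonzero constant
    separates.\<close>
  then have "X = {} \<or> Y = {}" using alternates_2[of _ X _ Y] by (metis add_0 disjoint_iff ex_in_conv)
  then show ?case by (elim disjE) (auto intro: exI[of _ "[:1:]"] exI[of _ "[:-1:]"])
next
  case (Suc m)
  \<comment> \<open>By symmetry the rightmost point belongs to \<open>X\<close>; the other case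
    negates the polynomial.\<close>
  have main: "?sep (Suc m) X Y"
    if fin: "finite X" "finite Y" and XY: "X \<inter> Y = {}" and na: "\<not> alternates (Suc m + 2) X Y"
      and ne: "X \<noteq> {}" "Y \<noteq> {}" and max: "Max Y < Max X" for X Y :: "real set"
  proof -
    define y where "y = Max Y"
    define X0 where "X0 = {x \<in> X. x < y}"
    define X1 where "X1 = {x \<in> X. y < x}"
    have y: "y \<in> Y" "\<And>v. v \<in> Y \<Longrightarrow> v \<le> y" using fin ne by (auto simp: y_def)
    have X: "X = X0 \<union> X1" using y XY by (auto simp: X0_def X1_def)
    have zX: "Max X \<in> X" using fin ne by simp
    then have X1: "finite X1" "X1 \<noteq> {}" using max fin by (auto simp: X1_def y_def)
    have lt: "u < Max X" if "u \<in> Y" for u using y(2)[OF that] max by (simp add: y_def)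
    \<comment> \<open>Dropping the points of \<open>X\<close> beyond \<open>y\<close> costs one
      alternation: a chain through \<open>X0\<close> and \<open>Y\<close> could be continued by
      \<open>Max X\<close> or by \<open>y\<close>.\<close>
    have "\<not> alternates (m + 2) X0 Y"
    proof
      assume alt: "alternates (m + 2) X0 Y"
      have "alternates (Suc (m + 2)) X Y"
        by (rule alternates_append[OF alt, of _ _ "Max X" y])
          (use zX y(1) lt in \<open>auto simp: X0_def\<close>)
      then show False using na by simp
    qed
    moreover have "finite X0" "X0 \<inter> Y = {}" using fin XY by (auto simp: X0_def)
    ultimately have "?sep m X0 Y" using Suc.IH fin by blast
    then obtain q where q: "degree q \<le> m" "\<forall>x\<in>X0. 0 < poly q x" "\<forall>y\<in>Y. poly q y < 0"
      "\<forall>s t. s \<le> t \<and> (\<forall>w\<in>X0 \<union> Y. w \<le> s) \<longrightarrow> 0 < poly q s * poly q t"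
      by blast
    have qneg: "poly q t < 0" if "y \<le> t" for t
    proof -
      have "0 < poly q y * poly q t" 
        by (rule q(4)[rule_format]) (use that y(2) in \<open>auto simp: X0_def intro: less_imp_le\<close>)
      moreover have "poly q y < 0" using q(3) y(1) by blast
      ultimately show ?thesis by (simp add: zero_less_mult_iff)
    qed
    \<comment> \<open>The new root lies strictly between \<open>y\<close> and \<open>X1\<close>. The
      factor \<open>c - t\<close> preserves the signs to its left and makes the negative values of
      \<open>q\<close> to its right positive.\<close>
    define c where "c = (y + Min X1) / 2"
    have "y < Min X1" using X1 by (auto simp: X1_def)
    then have "y < c" "c < Min X1" by (auto simp: c_def)
    then have c: "y < c" "\<And>x. x \<in> X1 \<Longrightarrow> c < x"
      using Min_le[OF X1(1)] by (auto intro: less_le_trans)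
    define p where "p = q * [:c, -1:]"
    have pe: "poly p t = poly q t * (c - t)" for t by (simp add: p_def algebra_simps)
    have "degree p \<le> Suc m"
      using degree_mult_le[of q "[:c, -1:]"] q(1) by (simp add: p_def)
    moreover have "0 < poly p x" if "x \<in> X" for x
    proof (cases "x \<in> X0")
      case True
      then have "x < c" using c(1) by (auto simp: X0_def)
      then show ?thesis using q(2) True by (simp add: pe)
    next
      case False
      then have "x \<in> X1" using X that by auto
      then have "c < x" "poly q x < 0" using c qneg[of x] by (auto simp: X1_def)
      then show ?thesis by (simp add: pe mult_neg_neg)
    qed
    moreover have "poly p v < 0" if "v \<in> Y" for v
    proof -
      have "v < c" "poly q v < 0" using y(2)[OF that] c(1) q(3) that by auto
      then show ?thesis by (simp add: pe mult_neg_pos)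
    qed
    moreover have "0 < poly p s * poly p t" if st: "s \<le> t" "\<forall>w\<in>X \<union> Y. w \<le> s" for s t
    proof -
      obtain x where "x \<in> X1" using X1(2) by blast
      then have "c < x" "x \<le> s" using c(2) st(2) X by auto
      then have "c < s" "c < t" "y \<le> s" "y \<le> t" using st(1) c(1) by auto
      then have "0 < poly p s" "0 < poly p t" using qneg by (simp_all add: pe mult_neg_neg)
      then show ?thesis by simp
    qed
    ultimately show ?thesis by blast
  qed
  show ?case
  proof (cases "X = {} \<or> Y = {}")
    case True
    then show ?thesis by (elim disjE) (auto intro: exI[of _ "[:1:]"] exI[of _ "[:-1:]"])
  next
    case False
    then have "Max X \<in> X" "Max Y \<in> Y" using Suc.prems by auto
    then consider "Max Y < Max X" | "Max X < Max Y"
      using Suc.prems(3) by (metis disjoint_iff linorder_neqE)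
    then show ?thesis
    proof cases
      case 1
      then show ?thesis using main Suc.prems False by blast
    next
      case 2
      have "?sep (Suc m) Y X"
        using main[of Y X] 2 Suc.prems False alternates_commute[of "Suc m + 2" X Y] by blast
      then obtain q where q: "degree q \<le> Suc m" "\<forall>x\<in>Y. 0 < poly q x" "\<forall>y\<in>X. poly q y < 0"
        "\<forall>s t. s \<le> t \<and> (\<forall>w\<in>Y \<union> X. w \<le> s) \<longrightarrow> 0 < poly q s * poly q t" by blast
      then show ?thesis by (intro exI[of _ "- q"]) (auto simp: Un_commute)
    qed
  qed
qed

section \<open>Polynomials and linear algebra in \<open>Rn d\<close>\<close>

lemma lookup_scaleR [simp]: "Poly_Mapping.lookup (r *\<^sub>R x) i = r *\<^sub>R Poly_Mapping.lookup x i"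
  by (simp add: scaleR_poly_mapping_def)

text \<open>Coordinates start at 0, so coordinate \<open>i\<close> carries the power
  \<open>Suc i\<close>. The constant power is left to the constant term of affine
  functionals.\<close>

definition moment :: "nat \<Rightarrow> real \<Rightarrow> point" where
  "moment d t = (\<Sum>i<d. Poly_Mapping.single i (t ^ Suc i))"

lemma lookup_moment: "Poly_Mapping.lookup (moment d t) i = (if i < d then t ^ Suc i else 0)"
proof -
  have "Poly_Mapping.lookup (moment d t) i = (\<Sum>j<d. if j = i then t ^ Suc j else 0)"
    unfolding moment_def lookup_sum by (intro sum.cong) (auto simp: lookup_single when_def)
  then show ?thesis by simp
qed

lemma moment_in_Rn: "moment d t \<in> Rn d"
  by (auto simp: Rn_def in_keys_iff lookup_moment split: if_splits)

lemma inj_moment: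
  assumes "1 \<le> d"
  shows "inj (moment d)"
proof (rule injI)
  fix s t assume "moment d s = moment d t"
  then have "Poly_Mapping.lookup (moment d s) 0 = Poly_Mapping.lookup (moment d t) 0" by simp
  then show "s = t" using assms by (simp add: lookup_moment)
qed

lemma Rn_subset_span: "Rn d \<subseteq> span ((\<lambda>i. Poly_Mapping.single i (1::real)) ` {..<d})"
proof
  fix x assume x: "x \<in> Rn d"
  have "x = (\<Sum>i<d. Poly_Mapping.lookup x i *\<^sub>R Poly_Mapping.single i (1::real))" (is "x = ?s")
  proof (rule poly_mapping_eqI)
    fix j
    have "Poly_Mapping.lookup ?s j = (\<Sum>i<d. if i = j then Poly_Mapping.lookup x i else 0)"
      unfolding lookup_sum by (intro sum.cong) (auto simp: lookup_single when_def)
    moreover have "\<not> j < d \<Longrightarrow> Poly_Mapping.lookup x j = 0"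
      using x by (auto simp: Rn_def subset_iff in_keys_iff)
    ultimately show "Poly_Mapping.lookup x j = Poly_Mapping.lookup ?s j" by simp
  qed
  also have "\<dots> \<in> span ((\<lambda>i. Poly_Mapping.single i (1::real)) ` {..<d})"
    by (intro span_sum span_scale span_base) auto
  finally show "x \<in> span ((\<lambda>i. Poly_Mapping.single i (1::real)) ` {..<d})" .
qed

text \<open>\<open>Rn d\<close> is spanned by \<open>d\<close> unit vectors. Finiteness has to be
  stated because the ambient space is infinite-dimensional.\<close>

lemma independent_in_Rn:
  assumes "independent S" "S \<subseteq> Rn d"
  shows "finite S" "card S \<le> d"
proof -
  have "finite S \<and> card S \<le> card ((\<lambda>i. Poly_Mapping.single i (1::real)) ` {..<d})"
    using assms Rn_subset_span by (intro independent_span_bound) auto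
  moreover have "card ((\<lambda>i. Poly_Mapping.single i (1::real)) ` {..<d}) \<le> d"
    using card_image_le[of "{..<d}"] by fastforce
  ultimately show "finite S" "card S \<le> d" by auto
qed

definition linear_part :: "nat \<Rightarrow> real poly \<Rightarrow> point \<Rightarrow> real" where
  "linear_part d q x = (\<Sum>i<d. coeff q (Suc i) * Poly_Mapping.lookup x i)"

lemma linear_linear_part: "linear (linear_part d q)"
  unfolding linear_part_def
  by (intro linearI)
    (simp_all add: lookup_add distrib_left sum.distrib sum_distrib_left mult.left_commute)

text \<open>Along the curve a polynomial of degree at most \<open>d\<close> is an affine functional,
  so signs of polynomials become sides of hyperplanes.\<close>

lemma linear_part_moment:
  assumes "degree q \<le> d"
  shows "poly q t = coeff q 0 + linear_part d q (moment d t)"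
proof -
  have "poly q t = (\<Sum>i\<le>d. coeff q i * t ^ i)"
    unfolding poly_altdef using assms
    by (intro sum.mono_neutral_left) (auto simp: coeff_eq_0)
  also have "\<dots> = coeff q 0 + (\<Sum>i<d. coeff q (Suc i) * t ^ Suc i)"
    by (simp add: sum.atMost_shift)
  also have "(\<Sum>i<d. coeff q (Suc i) * t ^ Suc i) = linear_part d q (moment d t)"
    unfolding linear_part_def by (intro sum.cong) (auto simp: lookup_moment)
  finally show ?thesis .
qed

section \<open>Convex hulls on the moment curve\<close>

text \<open>The separating polynomial gives a hyperplane with the two point sets in opposite open
  half-spaces, which are convex.\<close>

lemma convex_hull_moment_disjoint:
  assumes "finite X" "finite Y" "X \<inter> Y = {}" "\<not> alternates (d + 2) X Y"
  shows "convex hull (moment d ` X) \<inter> convex hull (moment d ` Y) = {}"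
proof -
  obtain q where q: "degree q \<le> d" "\<forall>x\<in>X. 0 < poly q x" "\<forall>y\<in>Y. poly q y < 0"
    using exists_separating_poly[OF assms] by blast
  let ?L = "linear_part d q"
  have "convex hull (moment d ` X) \<subseteq> ?L -` {- coeff q 0 <..}"
    using q linear_part_moment[OF q(1)]
    by (intro hull_minimal convex_linear_vimage linear_linear_part) auto
  moreover have "convex hull (moment d ` Y) \<subseteq> ?L -` {..< - coeff q 0}"
    using q linear_part_moment[OF q(1)]
    by (intro hull_minimal convex_linear_vimage linear_linear_part) auto
  ultimately show ?thesis by force
qed

text \<open>Otherwise a polynomial \<open>q\<close> has the sign of \<open>u\<close> wherever
  \<open>u\<close> is nonzero, so the sum of \<open>u t * poly q t\<close> is positive. But this sum
  is an affine functional applied to an affine relation, hence 0.\<close>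

lemma alternates_if_affine_relation:
  assumes "finite T" "(\<Sum>t\<in>T. u t) = 0" "(\<Sum>t\<in>T. u t *\<^sub>R moment d t) = 0" "\<exists>t\<in>T. u t \<noteq> 0"
  shows "alternates (d + 2) {t \<in> T. 0 < u t} {t \<in> T. u t < 0}"
proof (rule ccontr)
  assume "\<not> ?thesis"
  then obtain q where q: "degree q \<le> d" "\<forall>x\<in>{t \<in> T. 0 < u t}. 0 < poly q x"
      "\<forall>y\<in>{t \<in> T. u t < 0}. poly q y < 0"
    using exists_separating_poly[of "{t \<in> T. 0 < u t}" "{t \<in> T. u t < 0}" d] assms(1) by fastforce
  interpret linear "linear_part d q" by (rule linear_linear_part)
  have "(\<Sum>t\<in>T. u t * poly q t) = (\<Sum>t\<in>T. u t) * coeff q 0 + linear_part d q (\<Sum>t\<in>T. u t *\<^sub>R moment d t)"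
    by (simp add: linear_part_moment[OF q(1)] sum scale distrib_left sum.distrib sum_distrib_right)
  also have "\<dots> = 0" using assms(2,3) zero by simp
  finally have 0: "(\<Sum>t\<in>T. u t * poly q t) = 0" .
  have pos: "0 < u t * poly q t" if "t \<in> T" "u t \<noteq> 0" for t
    using q that by (cases "0 < u t") (auto simp: mult_neg_neg)
  have "0 < (\<Sum>t\<in>T. u t * poly q t)"
  proof -
    obtain t where "t \<in> T" "u t \<noteq> 0" using assms(4) by blast
    moreover have "0 \<le> u t * poly q t" if "t \<in> T" for t
      using pos[OF that] by (cases "u t = 0") auto
    ultimately show ?thesis using pos assms(1) by (intro sum_pos2) auto
  qed
  then show False using 0 by simp
qed

lemma moment_affine_relation:
  assumes "1 \<le> d" "finite T" "affine_dependent (moment d ` T)"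
  obtains u where "(\<Sum>t\<in>T. u t) = 0" "(\<Sum>t\<in>T. u t *\<^sub>R moment d t) = 0" "\<exists>t\<in>T. u t \<noteq> 0"
proof -
  have inj: "inj_on (moment d) T" using inj_moment[OF assms(1)] inj_on_subset by blast
  have "\<exists>U. sum U (moment d ` T) = 0 \<and> (\<exists>v\<in>moment d ` T. U v \<noteq> 0) \<and>
      (\<Sum>v\<in>moment d ` T. U v *\<^sub>R v) = 0"
    using affine_dependent_explicit_finite[THEN iffD1, OF _ assms(3)] assms(2) by simp
  then obtain U where U: "sum U (moment d ` T) = 0" "\<exists>v\<in>moment d ` T. U v \<noteq> 0"
      "(\<Sum>v\<in>moment d ` T. U v *\<^sub>R v) = 0"
    by (elim exE conjE) (rule that; assumption)
  show thesis
    by (rule that[of "U \<circ> moment d"]) (use U in \<open>simp_all add: sum.reindex[OF inj] o_def\<close>)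
qed

text \<open>The coefficients of an affine relation alternate in sign \<open>d + 2\<close> times,
  which takes \<open>d + 2\<close> parameters.\<close>

lemma moment_affine_independent:
  assumes "1 \<le> d" "finite T" "card T \<le> d + 1"
  shows "\<not> affine_dependent (moment d ` T)"
proof
  assume "affine_dependent (moment d ` T)"
  then obtain u where "(\<Sum>t\<in>T. u t) = 0" "(\<Sum>t\<in>T. u t *\<^sub>R moment d t) = 0" "\<exists>t\<in>T. u t \<noteq> 0"
    using moment_affine_relation[OF assms(1,2)] by blast
  then have "alternates (d + 2) {t \<in> T. 0 < u t} {t \<in> T. u t < 0}"
    using alternates_if_affine_relation assms(2) by blast
  then have "d + 2 \<le> card T" by (rule card_if_alternates) (use assms(2) in auto)
  then show False using assms(3) by simp
qed

lemma Rn_diff: "x \<in> Rn d \<Longrightarrow> y \<in> Rn d \<Longrightarrow> x - y \<in> Rn d"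
  using keys_diff[of x y] by (auto simp: Rn_def)

text \<open>Translated by one of the points, the others would contain \<open>d + 1\<close>
  independent vectors of \<open>Rn d\<close>.\<close>

lemma affine_dependent_if_card:
  assumes "S \<subseteq> Rn d" "d + 2 \<le> card S"
  shows "affine_dependent S"
proof (rule ccontr)
  assume "\<not> affine_dependent S"
  obtain a where a: "a \<in> S" using assms(2) by fastforce
  let ?D = "(\<lambda>x. - a + x) ` (S - {a})"
  have ind: "independent ?D"
    using \<open>\<not> affine_dependent S\<close> affine_dependent_iff_dependent2[OF a] by blast
  have "?D \<subseteq> Rn d" using Rn_diff[of _ d a] assms(1) a by auto
  then have "card ?D \<le> d" by (rule independent_in_Rn[OF ind])
  moreover have "card ?D = card (S - {a})" by (intro card_image) (auto simp: inj_on_def)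
  moreover have "card (S - {a}) = card S - 1" using a by simp
  ultimately show False using assms(2) by simp
qed

text \<open>A Radon argument: the \<open>d + 2\<close> points of the chain are affinely dependent,
  and the signs of the relation alternate along all of them. So the two sign classes are the two
  parity classes of the chain, and they share a convex combination.\<close>

lemma convex_hull_moment_intersect:
  assumes "1 \<le> d" "alternating (d + 2) X Y f" "X \<inter> Y = {}"
  shows "convex hull (moment d ` X) \<inter> convex hull (moment d ` Y) \<noteq> {}"
proof -
  define T where "T = f ` {..<d + 2}"
  have "inj_on f {..<d + 2}"
    using alternating_strict_mono[OF assms(2)] by (intro linorder_inj_onI) fastforce+
  then have cT: "card T = d + 2" and fT: "finite T" by (simp_all add: T_def card_image)
  have "card (moment d ` T) = d + 2"
    using cT inj_moment[OF assms(1)] by (metis card_image inj_on_subset subset_UNIV)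
  then have "affine_dependent (moment d ` T)"
    by (intro affine_dependent_if_card[of _ d]) (auto simp: moment_in_Rn)
  then obtain u where u: "(\<Sum>t\<in>T. u t) = 0" "(\<Sum>t\<in>T. u t *\<^sub>R moment d t) = 0" "\<exists>t\<in>T. u t \<noteq> 0"
    using moment_affine_relation[OF assms(1) fT] by blast
  define A where "A = {t \<in> T. 0 < u t}"
  define B where "B = {t \<in> T. u t < 0}"
  have AB: "A \<inter> B = {}" "finite A" "finite B" using fT by (auto simp: A_def B_def)
  have alt: "alternates (d + 2) A B"
    unfolding A_def B_def by (rule alternates_if_affine_relation[OF fT u])
  have fi: "f i \<in> (if even i then X else Y)" if "i < d + 2" for i
    using assms(2) that unfolding alternating_def by blast
  \<comment> \<open>\<open>T\<close> has only \<open>d + 2\<close> elements, so an alternation of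
    this length inside \<open>T\<close> is the chain \<open>f\<close> itself.\<close>
  have sub: "A' \<subseteq> X \<and> B' \<subseteq> Y" if g: "alternating (d + 2) A' B' g" and "A' \<inter> B' = {}" "A' \<union> B' \<subseteq> T" for A' B' g
  proof -
    have gi: "g i \<in> (if even i then A' else B')" if "i < d + 2" for i
      using g that unfolding alternating_def by blast
    have "g ` {..<d + 2} \<subseteq> f ` {..<d + 2}"
      using gi that(3) unfolding T_def[symmetric] by (force split: if_splits)
    then have fg: "f i = g i" if "i < d + 2" for i
      using alternating_unique[OF assms(2) g] that by blast
    have "(f i \<in> A' \<longrightarrow> f i \<in> X) \<and> (f i \<in> B' \<longrightarrow> f i \<in> Y)" if "i < d + 2" for i
      using gi[OF that] fi[OF that] fg[OF that] \<open>A' \<inter> B' = {}\<close> by (auto split: if_splits)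
    then show ?thesis using that(3) unfolding T_def by blast
  qed
  have ABT: "A \<union> B \<subseteq> T" "B \<union> A \<subseteq> T" by (auto simp: A_def B_def)
  have XY: "A \<subseteq> X \<and> B \<subseteq> Y \<or> B \<subseteq> X \<and> A \<subseteq> Y"
    using alt sub[of A B] sub[of B A] AB(1) ABT unfolding alternates_def by blast
  have split: "(\<Sum>t\<in>T. h t) = (\<Sum>t\<in>A. h t) + (\<Sum>t\<in>B. h t)" if "\<And>t. u t = 0 \<Longrightarrow> h t = 0"
    for h :: "real \<Rightarrow> 'b::comm_monoid_add"
  proof -
    have "(\<Sum>t\<in>T. h t) = (\<Sum>t\<in>A \<union> B. h t)"
    proof (intro sum.mono_neutral_right ballI fT)
      fix t assume "t \<in> T - (A \<union> B)"
      then have "u t = 0" by (auto simp: A_def B_def)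
      then show "h t = 0" by (rule that)
    qed (auto simp: A_def B_def)
    then show ?thesis using AB by (simp add: sum.union_disjoint)
  qed
  define s where "s = (\<Sum>t\<in>A. u t)"
  have sB: "(\<Sum>t\<in>B. - u t) = s" using split[of u] u(1) by (simp add: s_def sum_negf)
  \<comment> \<open>Either sign class may be the one known to be nonempty, but both have total
    absolute weight \<open>s\<close>.\<close>
  have "s > 0"
  proof -
    have "A \<noteq> {} \<or> B \<noteq> {}" using u(3) by (fastforce simp: A_def B_def)
    then show ?thesis
    proof
      assume "A \<noteq> {}"
      then show ?thesis unfolding s_def using AB by (intro sum_pos) (auto simp: A_def)
    next
      assume "B \<noteq> {}"
      then show ?thesis unfolding sB[symmetric] using AB by (intro sum_pos) (auto simp: B_def)
    qed
  qed
  \<comment> \<open>The Radon point: the normalised positive part of the relation, equal to its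
    normalised negative part.\<close>
  define z where "z = (\<Sum>t\<in>A. (u t / s) *\<^sub>R moment d t)"
  have zA: "z \<in> convex hull (moment d ` A)"
    unfolding z_def using AB \<open>s > 0\<close>
    by (intro convex_sum) (auto simp: A_def s_def hull_inc simp flip: sum_divide_distrib)
  have "(\<Sum>t\<in>A. u t *\<^sub>R moment d t) = (\<Sum>t\<in>B. (- u t) *\<^sub>R moment d t)"
    using split[of "\<lambda>t. u t *\<^sub>R moment d t"] u(2) by (simp add: sum_negf eq_neg_iff_add_eq_0)
  then have "(1 / s) *\<^sub>R (\<Sum>t\<in>A. u t *\<^sub>R moment d t) = (1 / s) *\<^sub>R (\<Sum>t\<in>B. (- u t) *\<^sub>R moment d t)"
    by (rule arg_cong)
  then have "z = (\<Sum>t\<in>B. (- u t / s) *\<^sub>R moment d t)"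
    by (simp add: z_def scaleR_sum_right)
  also have "\<dots> \<in> convex hull (moment d ` B)"
  proof (intro convex_sum AB)
    show "(\<Sum>t\<in>B. - u t / s) = 1" using sB \<open>s > 0\<close> by (simp only: sum_divide_distrib[symmetric]) simp
    show "0 \<le> - u t / s" if "t \<in> B" for t using that \<open>s > 0\<close> by (simp add: B_def divide_nonpos_pos)
  qed (auto simp: hull_inc)
  finally have zB: "z \<in> convex hull (moment d ` B)" .
  have mono: "convex hull (moment d ` P) \<subseteq> convex hull (moment d ` Q)" if "P \<subseteq> Q" for P Q
    using that by (intro hull_mono image_mono)
  show ?thesis using XY
  proof
    assume "A \<subseteq> X \<and> B \<subseteq> Y"
    then show ?thesis using mono[of A X] mono[of B Y] zA zB by blast
  next
    assume "B \<subseteq> X \<and> A \<subseteq> Y"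
    then show ?thesis using mono[of B X] mono[of A Y] zA zB by blast
  qed
qed

lemma convex_hull_moment_intersect_iff:
  assumes "1 \<le> d" "finite X" "finite Y" "X \<inter> Y = {}"
  shows "convex hull (moment d ` X) \<inter> convex hull (moment d ` Y) \<noteq> {} \<longleftrightarrow> alternates (d + 2) X Y"
proof
  assume "convex hull (moment d ` X) \<inter> convex hull (moment d ` Y) \<noteq> {}"
  then show "alternates (d + 2) X Y" using convex_hull_moment_disjoint[OF assms(2-4)] by blast
next
  assume "alternates (d + 2) X Y"
  then obtain f where "alternating (d + 2) X Y f \<or> alternating (d + 2) Y X f"
    unfolding alternates_def by (rule exE)
  then show "convex hull (moment d ` X) \<inter> convex hull (moment d ` Y) \<noteq> {}"
  proof
    assume "alternating (d + 2) X Y f"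
    then show ?thesis by (rule convex_hull_moment_intersect[OF assms(1) _ assms(4)])
  next
    assume "alternating (d + 2) Y X f"
    then show ?thesis
      using convex_hull_moment_intersect[OF assms(1), of Y X f] assms(4) by (simp add: Int_commute)
  qed
qed

text \<open>Any \<open>k\<close> affinely independent points have \<open>k - 1\<close> independent
  differences, one more than fit into the direction space of a flat of dimension
  \<open>k - 2\<close>.\<close>

lemma general_position_moment:
  assumes "1 \<le> d"
  shows "general_position d (moment d ` T)"
  unfolding general_position_def
proof (intro allI impI notI)
  fix k assume k: "k \<le> d + 1"
    and "\<exists>Q A. Q \<subseteq> moment d ` T \<and> finite Q \<and> card Q = k \<and> flat d (int k - 2) A \<and> Q \<subseteq> A"
  then obtain Q A where Q: "Q \<subseteq> moment d ` T" "finite Q" "card Q = k" and A: "flat d (int k - 2) A" "Q \<subseteq> A"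
    by blast
  show False
  proof (cases "A = {}")
    \<comment> \<open>The empty flat has dimension -1, which forces \<open>k = 1\<close> although
      \<open>Q\<close> is empty.\<close>
    case True
    then show ?thesis using A Q by (auto simp: flat_def)
  next
    case False
    then obtain V where V: "subspace V" "affine_parallel V A" "int (dim V) = int k - 2" and AR: "A \<subseteq> Rn d"
      using A(1) unfolding flat_def by auto
    then have "k \<ge> 2" by linarith
    then obtain a where a: "a \<in> Q" using Q(3) by fastforce
    obtain b where b: "A = (\<lambda>x. b + x) ` V" using V(2) unfolding affine_parallel_def by blast
    have diff: "- x + y \<in> V" if xy: "x \<in> A" "y \<in> A" for x y
    proof -
      obtain v w where "v \<in> V" "w \<in> V" "x = b + v" "y = b + w" using xy b by blast
      then show ?thesis using subspace_diff[OF V(1), of w v] by simp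
    qed
    \<comment> \<open>This makes the basis of \<open>V\<close> chosen below finite.\<close>
    have "V \<subseteq> Rn d"
    proof
      fix v assume "v \<in> V"
      then have "b + v \<in> A" "b + 0 \<in> A" using b subspace_0[OF V(1)] by blast+
      then have "b + v \<in> Rn d" "b + 0 \<in> Rn d" using AR by blast+
      then show "v \<in> Rn d" using Rn_diff[of "b + v" d "b + 0"] by simp
    qed
    obtain T' where T': "T' \<subseteq> T" "Q = moment d ` T'" using Q(1) subset_imageE by metis
    have injT: "inj_on (moment d) T'" using inj_moment[OF assms] inj_on_subset by blast
    have "finite T'" "card T' = k"
      using Q(2,3) T'(2) injT by (auto simp: card_image finite_image_iff)
    then have "\<not> affine_dependent Q"
      unfolding T'(2) using moment_affine_independent[OF assms] k by blast
    let ?D = "(\<lambda>x. - a + x) ` (Q - {a})"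
    have ind: "independent ?D"
      using \<open>\<not> affine_dependent Q\<close> affine_dependent_iff_dependent2[OF a] by blast
    obtain B where B: "B \<subseteq> V" "independent B" "V \<subseteq> span B" "card B = dim V"
      by (rule basis_exists)
    have "finite B" using independent_in_Rn(1)[OF B(2)] B(1) \<open>V \<subseteq> Rn d\<close> by blast
    moreover have "?D \<subseteq> span B" using diff a A(2) B(3) by blast
    ultimately have "card ?D \<le> card B" using independent_span_bound[OF _ ind] by blast
    moreover have "card ?D = card (Q - {a})" by (intro card_image) (auto simp: inj_on_def)
    moreover have "card (Q - {a}) = k - 1" using a Q by simp
    ultimately show False using B(4) V(3) \<open>k \<ge> 2\<close> by linarith
  qed
qed

section \<open>Graphs that are not weakly Tverberg\<close>

lemma partition_induced_pair:
  assumes "\<forall>\<sigma>. \<sigma> \<subseteq> {1..n} \<longrightarrow> ((\<Inter>i\<in>\<sigma>. convex hull (B i)) \<noteq> {} \<longleftrightarrow> \<sigma> \<in> graph_complex n E)"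
    and "i \<in> {1..n}" "j \<in> {1..n}" "i \<noteq> j"
  shows "convex hull (B i) \<inter> convex hull (B j) \<noteq> {} \<longleftrightarrow> {i, j} \<in> E"
proof -
  have "(\<Inter>i\<in>{i, j}. convex hull (B i)) \<noteq> {} \<longleftrightarrow> {i, j} \<in> graph_complex n E"
    using assms(1)[rule_format, of "{i, j}"] assms(2,3) by blast
  then show ?thesis using assms(4) by (auto simp: graph_complex_def)
qed

lemma weakly_tverberg_if_tverberg: "tverberg d n \<Delta> \<Longrightarrow> weakly_tverberg d n \<Delta>"
  unfolding tverberg_def weakly_tverberg_def by (meson order_refl)

text \<open>The hypothesis is applied to points with natural parameters on the moment curve.
  \<open>X i\<close> collects the parameters of the \<open>i\<close>-th part, and intersection of
  hulls becomes alternation.\<close>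

lemma weakly_tverberg_alternates:
  assumes "1 \<le> d" "weakly_tverberg d n (graph_complex n E)"
  obtains X :: "nat \<Rightarrow> real set"
  where "\<And>i. i \<in> {1..n} \<Longrightarrow> finite (X i) \<and> X i \<noteq> {}"
    and "\<And>i j. i \<in> {1..n} \<Longrightarrow> j \<in> {1..n} \<Longrightarrow> i \<noteq> j \<Longrightarrow>
      X i \<inter> X j = {} \<and> (alternates (d + 2) (X i) (X j) \<longleftrightarrow> {i, j} \<in> E)"
proof -
  obtain C where C: "\<forall>P. finite P \<and> P \<subseteq> Rn d \<and> general_position d P \<and> C \<le> card P \<longrightarrow>
        (\<exists>Q\<subseteq>P. partition_induced n (graph_complex n E) Q)"
    using assms(2) unfolding weakly_tverberg_def by (rule exE)
  define T where "T = real ` {..<C}"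
  have "card (moment d ` T) = card T"
    using inj_moment[OF assms(1)] by (intro card_image) (auto intro: inj_on_subset)
  then have "C \<le> card (moment d ` T)" by (simp add: T_def card_image)
  then have "\<exists>Q\<subseteq>moment d ` T. partition_induced n (graph_complex n E) Q"
    using general_position_moment[OF assms(1)]
    by (intro C[rule_format]) (auto simp: T_def moment_in_Rn)
  then obtain Q B where Q: "Q \<subseteq> moment d ` T" and ne: "\<forall>i\<in>{1..n}. B i \<noteq> {}"
    and disj: "disjoint_family_on B {1..n}" and un: "(\<Union>i\<in>{1..n}. B i) = Q"
    and nerve: "\<forall>\<sigma>. \<sigma> \<subseteq> {1..n} \<longrightarrow> ((\<Inter>i\<in>\<sigma>. convex hull (B i)) \<noteq> {} \<longleftrightarrow> \<sigma> \<in> graph_complex n E)"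
    unfolding partition_induced_def by (elim exE conjE) (rule that; assumption)
  define X where "X = (\<lambda>i. {t \<in> T. moment d t \<in> B i})"
  have fin: "finite (X i)" for i by (simp add: X_def T_def)
  have B: "B i = moment d ` X i" if "i \<in> {1..n}" for i
    using that Q un by (force simp: X_def)
  show thesis
  proof (rule that)
    show "finite (X i) \<and> X i \<noteq> {}" if "i \<in> {1..n}" for i
      using fin ne B[OF that] that by auto
    show "X i \<inter> X j = {} \<and> (alternates (d + 2) (X i) (X j) \<longleftrightarrow> {i, j} \<in> E)"
      if ij: "i \<in> {1..n}" "j \<in> {1..n}" "i \<noteq> j" for i j
    proof
      have "B i \<inter> B j = {}" using disj ij unfolding disjoint_family_on_def by blast
      then show "X i \<inter> X j = {}" by (auto simp: X_def)
      then show "alternates (d + 2) (X i) (X j) \<longleftrightarrow> {i, j} \<in> E"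
        using convex_hull_moment_intersect_iff[OF assms(1) fin fin] partition_induced_pair[OF nerve ij]
          B[OF ij(1)] B[OF ij(2)] by simp
    qed
  qed
qed

theorem theorem1p1:
  fixes d :: nat
  assumes "d \<ge> 1"
  shows "\<exists>n E. simple_graph n E \<and>
           (\<forall>d'. 1 \<le> d' \<and> d' \<le> d \<longrightarrow>
              \<not> weakly_tverberg d' n (graph_complex n E) \<and>
              \<not> tverberg d' n (graph_complex n E))"
proof -
  \<comment> \<open>Dimension \<open>d'\<close> corresponds to chains of length
    \<open>d' + 2\<close>; since \<open>N\<close> serves all lengths up to \<open>d + 2\<close>, one
    graph serves all dimensions up to \<open>d\<close>.\<close>
  obtain N where N: "\<forall>k\<le>d + 2. \<forall>(a :: nat \<Rightarrow> real set) b. \<not> (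
     (\<forall>i<N. finite (a i) \<and> a i \<noteq> {}) \<and>
     (\<forall>i<N. \<forall>j<N. i \<noteq> j \<longrightarrow> a i \<inter> a j = {} \<and> \<not> alternates k (a i) (a j)) \<and>
     (\<forall>S T. S \<subseteq> {..<N} \<and> T \<subseteq> {..<N} \<and> S \<noteq> T \<longrightarrow> \<not> alternates k (b S) (b T)) \<and>
     (\<forall>i<N. \<forall>S. S \<subseteq> {..<N} \<longrightarrow> (alternates k (a i) (b S) \<longleftrightarrow> i \<in> S)))"
    using membership_graph_not_alternation_graph[of "d + 2"] by (elim exE) (rule that)
  \<comment> \<open>The vertices of the membership graph before they are renumbered by
    \<open>g\<close>.\<close>
  define V where "V = Inl ` {..<N} \<union> Inr ` Pow {..<N}"
  define n where "n = card V"
  have "finite V" by (simp add: V_def)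
  then obtain h where "bij_betw h {1..n} V" unfolding n_def by (rule ex_bij_betw_nat_finite_1[THEN exE])
  then have "bij_betw (inv_into {1..n} h) V {1..n}" by (rule bij_betw_inv_into)
  then obtain g where g: "bij_betw g V {1..n}" by blast
  have gV: "g p \<in> {1..n}" if "p \<in> V" for p using g that by (auto simp: bij_betw_def)
  have g_inj: "g p = g q \<longleftrightarrow> p = q" if "p \<in> V" "q \<in> V" for p q
    using g that by (auto simp: bij_betw_def inj_on_def)
  have V: "Inl i \<in> V \<longleftrightarrow> i < N" "Inr S \<in> V \<longleftrightarrow> S \<subseteq> {..<N}" for i S by (auto simp: V_def)
  define E where "E = {{g (Inl i), g (Inr S)} | i S. i < N \<and> S \<subseteq> {..<N} \<and> i \<in> S}"
  have E_iff: "{g p, g q} \<in> E \<longleftrightarrow>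
      (\<exists>i S. i \<in> S \<and> (p = Inl i \<and> q = Inr S \<or> q = Inl i \<and> p = Inr S))" if "p \<in> V" "q \<in> V" for p q
  proof
    assume "{g p, g q} \<in> E"
    then obtain i S where "i < N" "S \<subseteq> {..<N}" "i \<in> S" "{g p, g q} = {g (Inl i), g (Inr S)}"
      by (auto simp: E_def)
    then show "\<exists>i S. i \<in> S \<and> (p = Inl i \<and> q = Inr S \<or> q = Inl i \<and> p = Inr S)"
      using g_inj V that by (auto simp: doubleton_eq_iff)
  next
    assume "\<exists>i S. i \<in> S \<and> (p = Inl i \<and> q = Inr S \<or> q = Inl i \<and> p = Inr S)"
    then obtain i S where "i \<in> S" "p = Inl i \<and> q = Inr S \<or> q = Inl i \<and> p = Inr S" by blast
    moreover from this have "{g p, g q} = {g (Inl i), g (Inr S)}" "i < N" "S \<subseteq> {..<N}"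
      using that V by auto
    ultimately show "{g p, g q} \<in> E" unfolding E_def by blast
  qed
  have "simple_graph n E"
    unfolding simple_graph_def
  proof
    fix e assume "e \<in> E"
    then obtain i S where e: "e = {g (Inl i), g (Inr S)}" "i < N" "S \<subseteq> {..<N}" by (auto simp: E_def)
    then have "g (Inl i) \<noteq> g (Inr S)" using g_inj V by blast
    then show "e \<subseteq> {1..n} \<and> card e = 2" using e gV V by auto
  qed
  moreover have not_weak: "\<not> weakly_tverberg d' n (graph_complex n E)" if d': "1 \<le> d'" "d' \<le> d" for d'
  proof
    assume "weakly_tverberg d' n (graph_complex n E)"
    then obtain X :: "nat \<Rightarrow> real set" where X: "\<And>i. i \<in> {1..n} \<Longrightarrow> finite (X i) \<and> X i \<noteq> {}"
      "\<And>i j. i \<in> {1..n} \<Longrightarrow> j \<in> {1..n} \<Longrightarrow> i \<noteq> j \<Longrightarrow>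
        X i \<inter> X j = {} \<and> (alternates (d' + 2) (X i) (X j) \<longleftrightarrow> {i, j} \<in> E)"
      using weakly_tverberg_alternates[OF d'(1)] by blast
    have X': "X (g p) \<inter> X (g q) = {} \<and> (alternates (d' + 2) (X (g p)) (X (g q)) \<longleftrightarrow>
        (\<exists>i S. i \<in> S \<and> (p = Inl i \<and> q = Inr S \<or> q = Inl i \<and> p = Inr S)))"
      if pq: "p \<in> V" "q \<in> V" "p \<noteq> q" for p q
      using X(2)[OF gV[OF pq(1)] gV[OF pq(2)]] g_inj[OF pq(1,2)] pq(3) E_iff[OF pq(1,2)] by simp
    have "d' + 2 \<le> d + 2" using d' by simp
    then show False
    \<comment> \<open>The number \<open>i\<close> is represented by \<open>X (g (Inl i))\<close> and
      the subset \<open>S\<close> by \<open>X (g (Inr S))\<close>.\<close>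
    proof (rule N[rule_format, THEN notE])
      show "(\<forall>i<N. finite (X (g (Inl i))) \<and> X (g (Inl i)) \<noteq> {}) \<and>
        (\<forall>i<N. \<forall>j<N. i \<noteq> j \<longrightarrow> X (g (Inl i)) \<inter> X (g (Inl j)) = {} \<and>
          \<not> alternates (d' + 2) (X (g (Inl i))) (X (g (Inl j)))) \<and>
        (\<forall>S T. S \<subseteq> {..<N} \<and> T \<subseteq> {..<N} \<and> S \<noteq> T \<longrightarrow>
          \<not> alternates (d' + 2) (X (g (Inr S))) (X (g (Inr T)))) \<and>
        (\<forall>i<N. \<forall>S. S \<subseteq> {..<N} \<longrightarrow>
          (alternates (d' + 2) (X (g (Inl i))) (X (g (Inr S))) \<longleftrightarrow> i \<in> S))"
      proof (intro conjI allI impI)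
        fix i assume "i < N"
        then show "finite (X (g (Inl i)))" "X (g (Inl i)) \<noteq> {}" using X(1) gV V by blast+
      next
        fix i j assume "i < N" "j < N" "i \<noteq> j"
        then show "X (g (Inl i)) \<inter> X (g (Inl j)) = {}"
          "\<not> alternates (d' + 2) (X (g (Inl i))) (X (g (Inl j)))"
          using X'[of "Inl i" "Inl j"] V by simp_all
      next
        fix S T assume "S \<subseteq> {..<N} \<and> T \<subseteq> {..<N} \<and> S \<noteq> T"
        then show "\<not> alternates (d' + 2) (X (g (Inr S))) (X (g (Inr T)))"
          using X'[of "Inr S" "Inr T"] V by simp
      next
        fix i S assume "i < N" "S \<subseteq> {..<N}"
        then show "alternates (d' + 2) (X (g (Inl i))) (X (g (Inr S))) \<longleftrightarrow> i \<in> S"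
          using X'[of "Inl i" "Inr S"] V by simp
      qed
    qed
  qed
  moreover have "\<not> tverberg d' n (graph_complex n E)" if "1 \<le> d'" "d' \<le> d" for d'
    using not_weak[OF that] weakly_tverberg_if_tverberg by blast
  ultimately show ?thesis by blast
qed

end
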